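(* Consider the interconnected system $\dot x_i=f_i(t,x_1,\dots,x_m)$, $t\ge t_0$, $i\in\{1,\dots,m\}$, $m\ge2$, with $x_i\in\mathbb{R}^{n_i}$, $n_1+\cdots+n_m=n$, and let $K\subset\mathbb{R}^n$ be a compact set with nonempty interior. Let $A_{\mathrm N}(t,x)=[a_{ij}(t,x)]\in\mathbb{R}^{m\times m}$ be the interconnection matrix function $$a_{ii}(t,x):=\mu_i\big(J_{x_i}f_i(t,x)\big),\qquad a_{ij}(t,x):=\big\|J_{x_j}f_i(t,x)\big\|_{ij}\quad(i\ne j).$$ Then the topological entropy of the interconnected system satisfies $$h(f,t_0,K)\le n\max\{\hat\mu^*_{\mathrm N},\,0\},\qquad \hat\mu^*_{\mathrm N}:=\inf_{t_1\ge t_0}\ \limsup_{t\to\infty}\ \max_{v\in\operatorname{co}(\xi(t_1,t_0,K))}\mu_{\mathrm N}\big(A_{\mathrm N}(t,\xi(t,t_1,v))\big).$$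
   Context: Write $x=(x_1,\dots,x_m)\in\mathbb{R}^n$ and $f=(f_1,\dots,f_m)$. Standing assumptions: $f(t,x)$ is piecewise continuous in $t$, continuously differentiable in $x$, and $\dot x=f(t,x)$ is forward complete. $\xi(t,s,x)$ denotes the solution at time $t$ with state $x$ at time $s$, and $\xi(t,t_0,K):=\{\xi(t,t_0,x):x\in K\}$. $J_{x_j}f_i(t,v)$ is the Jacobian matrix of $f_i(t,x)$ with respect to $x_j$ at $x=v$. $\operatorname{co}$ denotes convex hull. Norms: for each $i$, a ("local") norm $|\cdot|_i$ on $\mathbb{R}^{n_i}$ is given, with induced norm $\|\cdot\|_i$ on $\mathbb{R}^{n_i\times n_i}$ and mixed induced norms $\|A\|_{ij}:=\max_{|v|_j=1}|Av|_i$ on $\mathbb{R}^{n_i\times n_j}$. Also given is a ("network") norm $|\cdot|_{\mathrm N}$ on $\mathbb{R}^m$ that is monotone: for all entrywise nonnegative $v,w\in\mathbb{R}^m$, $v\ge w$ entrywise implies $|v|_{\mathrm N}\ge|w|_{\mathrm N}$; its induced norm on $\mathbb{R}^{m\times m}$ is $\|\cdot\|_{\mathrm N}$. The matrix measure of an induced norm $\|\cdot\|$ is $\mu(A):=\lim_{t\searrow0}\frac{\|I+tA\|-1}{t}$; $\mu_i$ and $\mu_{\mathrm N}$ are the matrix measures of $\|\cdot\|_i$ and $\|\cdot\|_{\mathrm N}$. Topological entropy: fix a norm $|\cdot|$ on $\mathbb{R}^n$ (the entropy does not depend on this choice). For $T\ge0$, $\varepsilon>0$, let $B_{f,t_0}(x,\varepsilon,T):=\{\bar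 x\in\mathbb{R}^n:\max_{t\in[t_0,t_0+T]}|\xi(t,t_0,\bar x)-\xi(t,t_0,x)|<\varepsilon\}$. A subset $E\subset K$ is $(T,\varepsilon)$-spanning if $K\subset\bigcup_{x\in E}B_{f,t_0}(x,\varepsilon,T)$; $S(f,t_0,\varepsilon,T,K)$ is the minimal cardinality of a $(T,\varepsilon)$-spanning set. Then $h(f,t_0,K):=\lim_{\varepsilon\searrow0}\limsup_{T\to\infty}\frac1T\log S(f,t_0,\varepsilon,T,K)$ (natural logarithm).
   Formalization: Besides piecewise continuity in t and continuous differentiability in x, f is assumed locally Lipschitz in x, locally uniformly in t; without this the solution ξ need not be unique, e.g. for x' = 2t sin(πx/(2t²)) from 0 at t = 0. *)

theory Defs
  imports "HOL-Analysis.Analysis"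
begin

section \<open>Norms, induced norms and matrix measures\<close>

definition norm_on :: "'a::real_vector set \<Rightarrow> ('a \<Rightarrow> real) \<Rightarrow> bool" where
  "norm_on V p \<longleftrightarrow>
     (\<forall>x\<in>V. 0 \<le> p x \<and> (p x = 0 \<longleftrightarrow> x = 0)) \<and>
     (\<forall>c. \<forall>x\<in>V. p (c *\<^sub>R x) = \<bar>c\<bar> * p x) \<and>
     (\<forall>x\<in>V. \<forall>y\<in>V. p (x + y) \<le> p x + p y)"

definition monotone_norm :: "(real ^ 'm \<Rightarrow> real) \<Rightarrow> bool" where
  "monotone_norm p \<longleftrightarrow>
     (\<forall>v w. (\<forall>i. 0 \<le> w $ i) \<longrightarrow> (\<forall>i. w $ i \<le> v $ i) \<longrightarrow> p w \<le> p v)"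

text \<open>
  The coordinates \<open>'n\<close> are partitioned into blocks by a surjection \<open>blk :: 'n \<Rightarrow> 'm\<close>; block \<open>i\<close>
  has dimension \<open>card (blk -` {i})\<close>. Since this dimension depends on \<open>i\<close>, the space of the block
  is rendered as the subspace of vectors supported in it, and a matrix from block \<open>j\<close> to block
  \<open>i\<close> as a matrix padded with zeros outside the rows of \<open>i\<close> and the columns of \<open>j\<close>.
\<close>

definition block_space :: "('n \<Rightarrow> 'm) \<Rightarrow> 'm \<Rightarrow> (real ^ 'n) set" where
  "block_space blk i = {v. \<forall>k. blk k \<noteq> i \<longrightarrow> v $ k = 0}"

definition block_jacobian ::
  "('n \<Rightarrow> 'm) \<Rightarrow> 'm \<Rightarrow> 'm \<Rightarrow> (real ^ 'n \<Rightarrow> real ^ 'n) \<Rightarrow> real ^ 'n \<Rightarrow> real ^ 'n ^ 'n" where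
  "block_jacobian blk i j g v =
     (\<chi> k l. if blk k = i \<and> blk l = j then jacobian g (at v) $ k $ l else 0)"

text \<open>
  The norm of \<open>A\<close> as a map from \<open>V\<close> normed by \<open>q\<close> into a space normed by \<open>p\<close>. For a subspace
  \<open>V \<noteq> {0}\<close> the supremum is a maximum over a compact set.
\<close>

definition mixed_norm ::
  "(real ^ 'b) set \<Rightarrow> (real ^ 'b \<Rightarrow> real) \<Rightarrow> (real ^ 'a \<Rightarrow> real) \<Rightarrow> real ^ 'b ^ 'a \<Rightarrow> real" where
  "mixed_norm V q p A = (SUP v\<in>{v \<in> V. q v = 1}. p (A *v v))"

text \<open>
  For \<open>V = block_space blk i\<close> and a matrix padded as above, the full identity \<open>mat 1\<close> acts on \<open>V\<close>
  as the identity of the block, so this is the matrix measure of the diagonal block itself.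
\<close>

definition matrix_measure ::
  "(real ^ 'b) set \<Rightarrow> (real ^ 'b \<Rightarrow> real) \<Rightarrow> real ^ 'b ^ 'b \<Rightarrow> real" where
  "matrix_measure V p A =
     Lim (at_right 0) (\<lambda>t. (mixed_norm V p p (mat 1 + t *\<^sub>R A) - 1) / t)"

definition interconnection_matrix ::
  "('n \<Rightarrow> 'm) \<Rightarrow> ('m \<Rightarrow> real ^ 'n \<Rightarrow> real) \<Rightarrow> (real \<Rightarrow> real ^ 'n \<Rightarrow> real ^ 'n) \<Rightarrow>
   real \<Rightarrow> real ^ 'n \<Rightarrow> real ^ 'm ^ 'm" where
  "interconnection_matrix blk lnrm f t x =
     (\<chi> i j. if i = j
        then matrix_measure (block_space blk i) (lnrm i) (block_jacobian blk i i (f t) x)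
        else mixed_norm (block_space blk j) (lnrm j) (lnrm i) (block_jacobian blk i j (f t) x))"


section \<open>Solutions\<close>

definition piecewise_continuous_from :: "real \<Rightarrow> (real \<Rightarrow> 'a::topological_space) \<Rightarrow> bool" where
  "piecewise_continuous_from t0 g \<longleftrightarrow>
     (\<forall>T. finite {t \<in> {t0..T}. \<not> continuous (at t within {t0..}) g}) \<and>
     (\<forall>t\<ge>t0. \<exists>l. (g \<longlongrightarrow> l) (at_right t)) \<and>
     (\<forall>t>t0. \<exists>l. (g \<longlongrightarrow> l) (at_left t))"

definition C1_map :: "(real ^ 'n \<Rightarrow> real ^ 'n) \<Rightarrow> bool" where
  "C1_map g \<longleftrightarrow>
     (\<forall>x. g differentiable (at x)) \<and> continuous_on UNIV (\<lambda>x. jacobian g (at x))"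

text \<open>
  As \<open>f\<close> may jump in time, the equation is understood in integral form. It contains the initial
  condition (case \<open>t = s\<close>) and the continuity of \<open>u\<close> on \<open>{s..}\<close>.
\<close>

definition solves_from ::
  "(real \<Rightarrow> real ^ 'n \<Rightarrow> real ^ 'n) \<Rightarrow> real \<Rightarrow> real ^ 'n \<Rightarrow> (real \<Rightarrow> real ^ 'n) \<Rightarrow> bool" where
  "solves_from f s x u \<longleftrightarrow>
     (\<forall>t\<ge>s. ((\<lambda>\<tau>. f \<tau> (u \<tau>)) has_integral (u t - x)) {s..t})"

definition forward_complete :: "(real \<Rightarrow> real ^ 'n \<Rightarrow> real ^ 'n) \<Rightarrow> real \<Rightarrow> bool" where
  "forward_complete f t0 \<longleftrightarrow> (\<forall>s\<ge>t0. \<forall>x. \<exists>u. solves_from f s x u)"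

text \<open>
  \<open>sol f t s x\<close> is the state at time \<open>t \<ge> s\<close> of the solution with state \<open>x\<close> at time \<open>s\<close>. The
  description ranges over the value at \<open>t\<close>, because \<open>u\<close> is not determined before time \<open>s\<close>.
\<close>

definition sol ::
  "(real \<Rightarrow> real ^ 'n \<Rightarrow> real ^ 'n) \<Rightarrow> real \<Rightarrow> real \<Rightarrow> real ^ 'n \<Rightarrow> real ^ 'n" where
  "sol f t s x = (THE y. \<exists>u. solves_from f s x u \<and> u t = y)"


section \<open>Topological entropy\<close>

definition dyn_ball ::
  "(real ^ 'n \<Rightarrow> real) \<Rightarrow> (real \<Rightarrow> real ^ 'n \<Rightarrow> real ^ 'n) \<Rightarrow> real \<Rightarrow>
   real ^ 'n \<Rightarrow> real \<Rightarrow> real \<Rightarrow> (real ^ 'n) set" where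
  "dyn_ball p f t0 x \<epsilon> T =
     {y. (SUP t\<in>{t0..t0 + T}. p (sol f t t0 y - sol f t t0 x)) < \<epsilon>}"

definition spanning ::
  "(real ^ 'n \<Rightarrow> real) \<Rightarrow> (real \<Rightarrow> real ^ 'n \<Rightarrow> real ^ 'n) \<Rightarrow> real \<Rightarrow>
   real \<Rightarrow> real \<Rightarrow> (real ^ 'n) set \<Rightarrow> (real ^ 'n) set \<Rightarrow> bool" where
  "spanning p f t0 \<epsilon> T K E \<longleftrightarrow> E \<subseteq> K \<and> K \<subseteq> (\<Union>x\<in>E. dyn_ball p f t0 x \<epsilon> T)"

text \<open>
  Finite spanning sets exist for compact \<open>K\<close> because solutions depend continuously on the
  initial state. The finiteness condition is needed because \<open>card\<close> is \<open>0\<close> on infinite sets.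
\<close>

definition span_number ::
  "(real ^ 'n \<Rightarrow> real) \<Rightarrow> (real \<Rightarrow> real ^ 'n \<Rightarrow> real ^ 'n) \<Rightarrow> real \<Rightarrow>
   real \<Rightarrow> real \<Rightarrow> (real ^ 'n) set \<Rightarrow> nat" where
  "span_number p f t0 \<epsilon> T K = (INF E\<in>{E. finite E \<and> spanning p f t0 \<epsilon> T K E}. card E)"

definition top_entropy ::
  "(real ^ 'n \<Rightarrow> real) \<Rightarrow> (real \<Rightarrow> real ^ 'n \<Rightarrow> real ^ 'n) \<Rightarrow> real \<Rightarrow> (real ^ 'n) set \<Rightarrow> ereal" where
  "top_entropy p f t0 K =
     Lim (at_right 0) (\<lambda>\<epsilon>. Limsup at_top (\<lambda>T::real.
       ereal (1 / T * ln (real (span_number p f t0 \<epsilon> T K)))))"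


section \<open>The asymptotic measure of the interconnection\<close>

text \<open>
  The inner supremum is over a compact set; it is taken in \<open>ereal\<close>, as are the upper limit and
  the infimum, which need not be finite.
\<close>

definition asymp_measure ::
  "('n \<Rightarrow> 'm) \<Rightarrow> ('m \<Rightarrow> real ^ 'n \<Rightarrow> real) \<Rightarrow> (real ^ 'm \<Rightarrow> real) \<Rightarrow>
   (real \<Rightarrow> real ^ 'n \<Rightarrow> real ^ 'n) \<Rightarrow> real \<Rightarrow> (real ^ 'n) set \<Rightarrow> ereal" where
  "asymp_measure blk lnrm nnrm f t0 K =
     (INF t1\<in>{t0..}. Limsup at_top (\<lambda>t.
        SUP v\<in>convex hull (sol f t1 t0 ` K).
          ereal (matrix_measure UNIV nnrm (interconnection_matrix blk lnrm f t (sol f t t1 v)))))"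

end

theory Submission
  imports Defs
begin

text \<open>
  The local norms and the network norm compose to a norm on the whole space whose matrix measure at the
  Jacobian is at most the network measure of the interconnection matrix. Along a trajectory on which
  this measure is at most \<open>c\<close>, the distance to infinitesimally close trajectories therefore grows at most
  like \<open>exp (c t)\<close>. Integrating over a segment in the convex hull of the states reached at time \<open>t\<^sub>1\<close>
  gives the same bound for any two trajectories from the hull. If \<open>c \<ge> 0\<close>, a grid of mesh proportional
  to \<open>\<epsilon> exp (- c T)\<close>, with of the order of \<open>exp (n c T)\<close> points, is then \<open>(T, \<epsilon>)\<close>-spanning.
\<close>

section \<open>Norms on subspaces and matrix measures\<close>

text \<open>The data are rough in two ways. The norm has only one-sided directional derivatives, and
  \<open>f\<close> may jump at times that depend on the state, while its Jacobian need not be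
  continuous in time. So no variational equation and no linearised flow are formed: nonlinear
  solutions are compared directly, through right derivatives of their distance. This yields a local
  estimate whose neighbourhood depends on the point and on the final time \<open>T\<close>, but
  whose constant factor does not; along a segment such estimates add up, and the neighbourhoods
  disappear. This is why the hull enters: every starting point on the segment needs the measure
  bound. Segments lie at time \<open>t1\<close>, the bound holds only after a later time
  \<open>t2\<close>, and the flow in between costs a fixed factor. Fixed factors vanish in the
  exponential rate, so crude constants suffice. The sign of \<open>c\<close> matters because one
  mesh must resolve all times up to \<open>T\<close>, also early ones at which nothing has
  contracted yet.\<close>

lemma norm_onD:
  assumes "norm_on V p"
  shows "x \<in> V \<Longrightarrow> 0 \<le> p x"
    and "x \<in> V \<Longrightarrow> p x = 0 \<longleftrightarrow> x = 0"
    and "x \<in> V \<Longrightarrow> p (c *\<^sub>R x) = \<bar>c\<bar> * p x"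
    and "x \<in> V \<Longrightarrow> y \<in> V \<Longrightarrow> p (x + y) \<le> p x + p y"
  using assms unfolding norm_on_def by blast+

lemma norm_on_minus_commute:
  assumes "norm_on UNIV p"
  shows "p (x - y) = p (y - x)"
  using norm_onD(3)[OF assms, of "y - x" "-1"] by simp

lemma norm_on_sum:
  assumes p: "norm_on V p" and V: "subspace V" and "finite I" and "\<And>i. i \<in> I \<Longrightarrow> g i \<in> V"
  shows "p (sum g I) \<le> (\<Sum>i\<in>I. p (g i))"
  using assms(3,4)
proof (induction I)
  case empty
  show ?case using norm_onD(2)[OF p, of 0] subspace_0[OF V] by simp
next
  case (insert i I)
  have "p (g i + sum g I) \<le> p (g i) + p (sum g I)"
    by (rule norm_onD(4)[OF p]) (use insert.prems V in \<open>auto intro: subspace_sum\<close>)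
  then show ?case using insert by simp
qed

lemma norm_on_triangle_sub:
  assumes p: "norm_on V p" and V: "subspace V" and "x \<in> V" "y \<in> V"
  shows "\<bar>p x - p y\<bar> \<le> p (x - y)"
proof -
  have xy: "x - y \<in> V" using assms by (simp add: subspace_diff)
  have "p (y - x) = p (x - y)"
    using norm_onD(3)[OF p xy, of "-1"] by simp
  moreover have "p x \<le> p (x - y) + p y"
    using norm_onD(4)[OF p xy \<open>y \<in> V\<close>] by simp
  moreover have "p y \<le> p (y - x) + p x"
    using norm_onD(4)[OF p, of "y - x" x] assms by (simp add: subspace_diff)
  ultimately show ?thesis by simp
qed

text \<open>Expansion in an orthonormal basis of \<open>V\<close>, with the triangle inequality and
  Cauchy-Schwarz. A subspace is allowed because the local norms are norms only on their
  blocks.\<close>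

lemma norm_on_upper:
  fixes V :: "'a::euclidean_space set"
  assumes p: "norm_on V p" and V: "subspace V"
  obtains C where "C > 0" "\<And>v. v \<in> V \<Longrightarrow> p v \<le> C * norm v"
proof -
  obtain B where B: "B \<subseteq> V" "pairwise orthogonal B" "\<And>x. x \<in> B \<Longrightarrow> norm x = 1"
      "independent B" "span B = V"
    using orthonormal_basis_subspace[OF V] by metis
  have fin: "finite B" using B(4) by (simp add: independent_imp_finite)
  \<comment> \<open>The summand 1 keeps \<open>C\<close> positive when \<open>V = {0}\<close> and
    the basis is empty.\<close>
  define C where "C = (\<Sum>b\<in>B. p b) + 1"
  have pos: "(\<Sum>b\<in>B. p b) \<ge> 0"
    using B(1) norm_onD(1)[OF p] by (auto intro!: sum_nonneg)
  have "p v \<le> C * norm v" if v: "v \<in> V" for v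
  proof -
    have "v = (\<Sum>b\<in>B. (v \<bullet> b) *\<^sub>R b)"
      using orthonormal_basis_expand[OF B(2,3) _ fin, of v] v B(5) by simp
    then have "p v \<le> (\<Sum>b\<in>B. p ((v \<bullet> b) *\<^sub>R b))"
      using norm_on_sum[OF p V fin, of "\<lambda>b. (v \<bullet> b) *\<^sub>R b"] B(1) V
      by (auto simp: subspace_scale subset_iff)
    also have "\<dots> = (\<Sum>b\<in>B. \<bar>v \<bullet> b\<bar> * p b)"
      using B(1) norm_onD(3)[OF p] by (auto intro!: sum.cong)
    also have "\<dots> \<le> (\<Sum>b\<in>B. norm v * p b)"
    proof (rule sum_mono)
      fix b assume b: "b \<in> B"
      have "\<bar>v \<bullet> b\<bar> \<le> norm v" using Cauchy_Schwarz_ineq2[of v b] B(3)[OF b] by simp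
      then show "\<bar>v \<bullet> b\<bar> * p b \<le> norm v * p b"
        using b B(1) norm_onD(1)[OF p] by (intro mult_right_mono) auto
    qed
    also have "\<dots> \<le> C * norm v"
      by (simp add: C_def sum_distrib_left[symmetric] algebra_simps)
    finally show ?thesis .
  qed
  moreover have "C > 0" using pos by (simp add: C_def)
  ultimately show thesis using that by blast
qed

lemma norm_on_continuous:
  fixes V :: "'a::euclidean_space set"
  assumes p: "norm_on V p" and V: "subspace V"
  shows "continuous_on V p"
proof -
  obtain C where C: "C > 0" "\<And>v. v \<in> V \<Longrightarrow> p v \<le> C * norm v"
    using norm_on_upper[OF p V] by blast
  have "C-lipschitz_on V p"
  proof (rule lipschitz_onI)
    show "dist (p x) (p y) \<le> C * dist x y" if "x \<in> V" "y \<in> V" for x y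
      using norm_on_triangle_sub[OF p V that] C(2)[of "x - y"] that V
      by (simp add: dist_norm subspace_diff)
  qed (use C in simp)
  then show ?thesis by (rule lipschitz_on_continuous_on)
qed

text \<open>\<open>p\<close> has a positive minimum on the compact unit sphere of \<open>V\<close>,
  and homogeneity does the rest; for \<open>V = {0}\<close> the sphere is empty and any constant
  works. With \<open>norm_on_upper\<close> this allows passing between norms at the price of fixed
  factors.\<close>

lemma norm_on_lower:
  fixes V :: "'a::euclidean_space set"
  assumes p: "norm_on V p" and V: "subspace V"
  obtains c where "c > 0" "\<And>v. v \<in> V \<Longrightarrow> c * norm v \<le> p v"
proof (cases "V \<inter> sphere 0 1 = {}")
  case True
  have zero: "v = 0" if "v \<in> V" for v
  proof (rule ccontr)
    assume "v \<noteq> 0"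
    then have "(1 / norm v) *\<^sub>R v \<in> V \<inter> sphere 0 1"
      using that V by (simp add: subspace_scale)
    then show False using True by blast
  qed
  then have "1 * norm v \<le> p v" if "v \<in> V" for v
    using norm_onD(1)[OF p that] zero[OF that] by simp
  then show thesis using that[of 1] by simp
next
  case False
  have "compact (V \<inter> sphere 0 1)"
    using V by (simp add: closed_Int_compact closed_subspace)
  moreover have "continuous_on (V \<inter> sphere 0 1) p"
    using norm_on_continuous[OF p V] continuous_on_subset by blast
  ultimately obtain u where u: "u \<in> V \<inter> sphere 0 1" "\<And>v. v \<in> V \<inter> sphere 0 1 \<Longrightarrow> p u \<le> p v"
    using False continuous_attains_inf by metis
  have "p u > 0" using u(1) norm_onD(1,2)[OF p, of u] by auto
  moreover have "p u * norm v \<le> p v" if "v \<in> V" for v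
  proof (cases "v = 0")
    case True
    then show ?thesis using norm_onD(1)[OF p that] by simp
  next
    case False
    then have "(1 / norm v) *\<^sub>R v \<in> V \<inter> sphere 0 1"
      using that V by (simp add: subspace_scale)
    then have "p u \<le> p ((1 / norm v) *\<^sub>R v)" by (rule u(2))
    also have "\<dots> = p v / norm v" using norm_onD(3)[OF p that, of "1 / norm v"] by simp
    finally show ?thesis using False by (simp add: field_simps)
  qed
  ultimately show thesis using that by blast
qed

section \<open>One-sided directional derivatives of a norm\<close>

lemma norm_quotient_mono:
  assumes p: "norm_on UNIV p" and "0 < s" "s \<le> t"
  shows "(p (z + s *\<^sub>R w) - p z) / s \<le> (p (z + t *\<^sub>R w) - p z) / t"
proof -
  have "z + s *\<^sub>R w = (1 - s / t) *\<^sub>R z + (s / t) *\<^sub>R (z + t *\<^sub>R w)"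
    using assms by (simp add: algebra_simps)
  then have "p (z + s *\<^sub>R w) \<le> p ((1 - s / t) *\<^sub>R z) + p ((s / t) *\<^sub>R (z + t *\<^sub>R w))"
    using norm_onD(4)[OF p] by simp
  also have "\<dots> = (1 - s / t) * p z + (s / t) * p (z + t *\<^sub>R w)"
    using assms norm_onD(3)[OF p] by simp
  finally show ?thesis using assms by (simp add: field_simps)
qed

lemma mono_tendsto_at_right_0:
  fixes q :: "real \<Rightarrow> real"
  assumes "\<And>s t. 0 < s \<Longrightarrow> s \<le> t \<Longrightarrow> q s \<le> q t" and "\<And>t. 0 < t \<Longrightarrow> K \<le> q t"
  shows "(q \<longlongrightarrow> Inf (q ` {0<..})) (at_right 0)"
  using Lim_right_bound[of UNIV 0 q K] assms by simp

text \<open>The one-sided derivative of \<open>p\<close> at \<open>z\<close> in direction \<open>w\<close>: by convexity the infimum of the difference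
  quotients is their limit.\<close>
definition norm_dd :: "('a::real_vector \<Rightarrow> real) \<Rightarrow> 'a \<Rightarrow> 'a \<Rightarrow> real" where
  "norm_dd p z w = Inf ((\<lambda>h. (p (z + h *\<^sub>R w) - p z) / h) ` {0<..})"

lemma norm_quotient_lower:
  assumes p: "norm_on UNIV p" and "0 < h"
  shows "- p w \<le> (p (z + h *\<^sub>R w) - p z) / h"
proof -
  have "p z \<le> p (z + h *\<^sub>R w) + p ((- h) *\<^sub>R w)"
    using norm_onD(4)[OF p, of "z + h *\<^sub>R w" "(- h) *\<^sub>R w"] by simp
  also have "p ((- h) *\<^sub>R w) = h * p w" using norm_onD(3)[OF p, of w "- h"] \<open>0 < h\<close> by simp
  finally show ?thesis using \<open>0 < h\<close> by (simp add: field_simps)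
qed

lemma norm_dd_tendsto:
  assumes p: "norm_on UNIV p"
  shows "((\<lambda>h. (p (z + h *\<^sub>R w) - p z) / h) \<longlongrightarrow> norm_dd p z w) (at_right 0)"
  unfolding norm_dd_def
  by (rule mono_tendsto_at_right_0[where K = "- p w"])
     (use norm_quotient_mono[OF p] norm_quotient_lower[OF p] in auto)

lemma norm_dd_le_quotient:
  assumes p: "norm_on UNIV p" and "0 < h"
  shows "norm_dd p z w \<le> (p (z + h *\<^sub>R w) - p z) / h"
  unfolding norm_dd_def
  by (rule cInf_lower) (use assms norm_quotient_lower[OF p] in \<open>auto intro!: bdd_belowI2\<close>)

text \<open>Subadditivity of \<open>p\<close> inside each quotient. This is how the nonlinear
  remainder of the vector field is split off from its linear part, at the cost of the norm of the
  remainder.\<close>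

lemma norm_dd_add_le:
  assumes p: "norm_on UNIV p"
  shows "norm_dd p z (w + e) \<le> norm_dd p z w + p e"
proof -
  have "((\<lambda>h. (p (z + h *\<^sub>R w) - p z) / h + p e) \<longlongrightarrow> norm_dd p z w + p e) (at_right 0)"
    by (intro tendsto_intros norm_dd_tendsto[OF p])
  moreover have "eventually (\<lambda>h. (p (z + h *\<^sub>R (w + e)) - p z) / h \<le> (p (z + h *\<^sub>R w) - p z) / h + p e) (at_right 0)"
  proof (rule eventually_at_rightI[of 0 1])
    fix h :: real assume h: "h \<in> {0<..<1}"
    have "p (z + h *\<^sub>R (w + e)) \<le> p (z + h *\<^sub>R w) + h * p e"
      using norm_onD(4)[OF p, of "z + h *\<^sub>R w" "h *\<^sub>R e"] norm_onD(3)[OF p, of e h] h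
      by (simp add: algebra_simps)
    then show "(p (z + h *\<^sub>R (w + e)) - p z) / h \<le> (p (z + h *\<^sub>R w) - p z) / h + p e"
      using h by (simp add: field_simps)
  qed simp
  ultimately show ?thesis
    by (rule tendsto_le[OF trivial_limit_at_right_real _ norm_dd_tendsto[OF p]])
qed

lemma norm_dd_bounds:
  assumes p: "norm_on UNIV p"
  shows "\<bar>norm_dd p z w\<bar> \<le> p w"
proof -
  have "norm_dd p z 0 = 0"
    using tendsto_unique[OF trivial_limit_at_right_real norm_dd_tendsto[OF p, of z 0]] by simp
  then have "norm_dd p z w \<le> p w" using norm_dd_add_le[OF p, of z 0 w] by simp
  moreover have "- p w \<le> norm_dd p z w"
    unfolding norm_dd_def by (rule cINF_greatest) (use norm_quotient_lower[OF p] in auto)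
  ultimately show ?thesis by simp
qed

text \<open>\<open>norm_dd\<close> lies below every difference quotient, so a single step
  \<open>h\<close> for each slack is enough and no limit has to be taken.\<close>

lemma norm_dd_le:
  assumes p: "norm_on UNIV p"
    and "\<And>\<epsilon>. \<epsilon> > 0 \<Longrightarrow> \<exists>h>0. p (z + h *\<^sub>R w) \<le> (1 + h * (c + \<epsilon>)) * p z"
  shows "norm_dd p z w \<le> c * p z"
proof (rule field_le_epsilon)
  fix e :: real assume e: "e > 0"
  \<comment> \<open>Dividing by \<open>p z + 1\<close> instead of \<open>p z\<close> also covers
    \<open>z = 0\<close>.\<close>
  define \<epsilon> where "\<epsilon> = e / (p z + 1)"
  have pz: "p z \<ge> 0" using norm_onD(1)[OF p] by simp
  have \<epsilon>: "\<epsilon> > 0" "\<epsilon> * p z \<le> e" using e pz by (auto simp: \<epsilon>_def field_simps)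
  obtain h where h: "h > 0" "p (z + h *\<^sub>R w) \<le> (1 + h * (c + \<epsilon>)) * p z"
    using assms(2)[OF \<epsilon>(1)] by blast
  have "norm_dd p z w \<le> (p (z + h *\<^sub>R w) - p z) / h" by (rule norm_dd_le_quotient[OF p h(1)])
  also have "\<dots> \<le> (c + \<epsilon>) * p z" using h by (simp add: field_simps)
  finally show "norm_dd p z w \<le> c * p z + e" using \<epsilon> by (simp add: algebra_simps)
qed

text \<open>A chain rule without differentiability of \<open>p\<close>: along the tangent line the
  quotient converges by \<open>norm_dd_tendsto\<close>, and replacing the tangent line by the curve
  changes it by at most \<open>p\<close> of the error \<open>r\<close> of the difference quotient,
  which tends to 0.\<close>

lemma norm_right_derivative:
  fixes z :: "real \<Rightarrow> 'a::euclidean_space"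
  assumes p: "norm_on UNIV p" and z: "(z has_vector_derivative w) (at_right t)"
  shows "((\<lambda>\<tau>. p (z \<tau>)) has_real_derivative norm_dd p (z t) w) (at_right t)"
proof -
  obtain C where C: "C > 0" "\<And>v. p v \<le> C * norm v"
    using norm_on_upper[OF p subspace_UNIV] by auto
  define r where "r \<tau> = (1 / (\<tau> - t)) *\<^sub>R (z \<tau> - z t) - w" for \<tau>
  have "((\<lambda>\<tau>. (1 / (\<tau> - t)) *\<^sub>R (z \<tau> - z t)) \<longlongrightarrow> w) (at_right t)"
  proof -
    have *: "((\<lambda>y. (1 / norm (y - t)) *\<^sub>R (z y - (z t + (y - t) *\<^sub>R w))) \<longlongrightarrow> 0) (at_right t)"
      using z unfolding has_vector_derivative_def has_derivative_within by simp
    have "((\<lambda>y. (1 / norm (y - t)) *\<^sub>R (z y - (z t + (y - t) *\<^sub>R w)) + w) \<longlongrightarrow> 0 + w) (at_right t)"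
      by (intro tendsto_intros *)
    moreover have "eventually (\<lambda>y. (1 / norm (y - t)) *\<^sub>R (z y - (z t + (y - t) *\<^sub>R w)) + w
        = (1 / (y - t)) *\<^sub>R (z y - z t)) (at_right t)"
    proof (rule eventually_at_rightI[of t "t + 1"])
      fix y assume y: "y \<in> {t<..<t + 1}"
      have "(1 / norm (y - t)) *\<^sub>R (z y - (z t + (y - t) *\<^sub>R w))
          = (1 / (y - t)) *\<^sub>R ((z y - z t) - (y - t) *\<^sub>R w)"
        using y by (simp add: diff_diff_eq)
      also have "\<dots> = (1 / (y - t)) *\<^sub>R (z y - z t) - ((1 / (y - t)) * (y - t)) *\<^sub>R w"
        by (simp only: scaleR_diff_right scaleR_scaleR)
      also have "(1 / (y - t)) * (y - t) = 1" using y by simp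
      finally show "(1 / norm (y - t)) *\<^sub>R (z y - (z t + (y - t) *\<^sub>R w)) + w = (1 / (y - t)) *\<^sub>R (z y - z t)"
        by simp
    qed simp
    ultimately show ?thesis using tendsto_cong by fastforce
  qed
  then have r: "(r \<longlongrightarrow> 0) (at_right t)"
    unfolding r_def by (auto intro: tendsto_eq_intros)
  have A: "((\<lambda>\<tau>. (p (z t + (\<tau> - t) *\<^sub>R w) - p (z t)) / (\<tau> - t)) \<longlongrightarrow> norm_dd p (z t) w) (at_right t)"
    using norm_dd_tendsto[OF p, of "z t" w]
    unfolding filterlim_at_right_to_0[of _ _ t] by simp
  have B: "((\<lambda>\<tau>. (p (z \<tau>) - p (z t + (\<tau> - t) *\<^sub>R w)) / (\<tau> - t)) \<longlongrightarrow> 0) (at_right t)"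
  proof (rule Lim_null_comparison)
    show "eventually (\<lambda>\<tau>. norm ((p (z \<tau>) - p (z t + (\<tau> - t) *\<^sub>R w)) / (\<tau> - t)) \<le> C * norm (r \<tau>)) (at_right t)"
    proof (rule eventually_at_rightI[of t "t + 1"])
      fix \<tau> assume \<tau>: "\<tau> \<in> {t<..<t + 1}"
      have eq: "z \<tau> - (z t + (\<tau> - t) *\<^sub>R w) = (\<tau> - t) *\<^sub>R r \<tau>"
        using \<tau> by (simp add: r_def algebra_simps)
      have "\<bar>p (z \<tau>) - p (z t + (\<tau> - t) *\<^sub>R w)\<bar> \<le> p ((\<tau> - t) *\<^sub>R r \<tau>)"
        using norm_on_triangle_sub[OF p subspace_UNIV, of "z \<tau>" "z t + (\<tau> - t) *\<^sub>R w"] eq by simp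
      also have "\<dots> = (\<tau> - t) * p (r \<tau>)" using norm_onD(3)[OF p] \<tau> by simp
      also have "\<dots> \<le> (\<tau> - t) * (C * norm (r \<tau>))" using C \<tau> by (intro mult_left_mono) auto
      finally show "norm ((p (z \<tau>) - p (z t + (\<tau> - t) *\<^sub>R w)) / (\<tau> - t)) \<le> C * norm (r \<tau>)"
        using \<tau> by (simp add: field_simps)
    qed simp
    show "((\<lambda>\<tau>. C * norm (r \<tau>)) \<longlongrightarrow> 0) (at_right t)"
      using tendsto_mult_left[OF tendsto_norm[OF r], of C] by simp
  qed
  show ?thesis
    unfolding has_field_derivative_iff
    using tendsto_add[OF A B] by (simp add: add_divide_distrib[symmetric])
qed

text \<open>A supremum of reals is meaningful only over a bounded set; comparing both norms with the
  Euclidean one gives the bound.\<close>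

lemma bdd_above_mixed_norm:
  fixes A :: "real ^ 'b ^ 'a"
  assumes q: "norm_on V q" and V: "subspace V" and p: "norm_on W p" and W: "subspace W"
    and A: "\<And>v. v \<in> V \<Longrightarrow> A *v v \<in> W"
  shows "bdd_above ((\<lambda>v. p (A *v v)) ` {v \<in> V. q v = 1})"
proof -
  obtain C where C: "C > 0" "\<And>v. v \<in> W \<Longrightarrow> p v \<le> C * norm v" using norm_on_upper[OF p W] by blast
  obtain c where c: "c > 0" "\<And>v. v \<in> V \<Longrightarrow> c * norm v \<le> q v" using norm_on_lower[OF q V] by blast
  obtain B where B: "B > 0" "\<And>v. norm (A *v v) \<le> norm v * B"
    using linear_bounded_pos[OF matrix_vector_mul_linear[of A]] by (metis mult.commute)
  show ?thesis
  proof (rule bdd_aboveI2)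
    fix v assume v: "v \<in> {v \<in> V. q v = 1}"
    have nv: "norm v \<le> 1 / c" using c(1) c(2)[of v] v by (simp add: field_simps)
    have "p (A *v v) \<le> C * norm (A *v v)" using C(2) A v by blast
    also have "\<dots> \<le> C * (norm v * B)" using B(2) C(1) by simp
    also have "\<dots> \<le> C * (1 / c * B)" using nv B(1) C(1) by (intro mult_left_mono mult_right_mono) auto
    finally show "p (A *v v) \<le> C * (1 / c * B)" .
  qed
qed

lemma mixed_norm_bound:
  fixes A :: "real ^ 'b ^ 'a"
  assumes q: "norm_on V q" and V: "subspace V" and p: "norm_on W p" and W: "subspace W"
    and A: "\<And>v. v \<in> V \<Longrightarrow> A *v v \<in> W" and v: "v \<in> V"
  shows "p (A *v v) \<le> mixed_norm V q p A * q v"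
proof (cases "v = 0")
  case True
  then show ?thesis using norm_onD(2)[OF p subspace_0[OF W]] norm_onD(2)[OF q subspace_0[OF V]] by simp
next
  case False
  then have qv: "q v > 0" using norm_onD(1,2)[OF q v] by simp
  have u: "(1 / q v) *\<^sub>R v \<in> {v \<in> V. q v = 1}"
    using v V qv norm_onD(3)[OF q v, of "1 / q v"] by (simp add: subspace_scale)
  have "p (A *v ((1 / q v) *\<^sub>R v)) \<le> mixed_norm V q p A"
    unfolding mixed_norm_def
    by (rule cSUP_upper[OF u bdd_above_mixed_norm[OF q V p W A]])
  moreover have "p (A *v ((1 / q v) *\<^sub>R v)) = p (A *v v) / q v"
    using norm_onD(3)[OF p A[OF v], of "1 / q v"] qv by (simp add: matrix_vector_mult_scaleR)
  ultimately show ?thesis using qv by (simp add: field_simps)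
qed

lemma norm_on_unit_vector:
  assumes q: "norm_on V q" and V: "subspace V" and "V \<noteq> {0}"
  obtains u where "u \<in> V" "q u = 1"
proof -
  obtain v where v: "v \<in> V" "v \<noteq> 0" using assms subspace_0[OF V] by blast
  then have "q v > 0" using norm_onD(1,2)[OF q v(1)] by simp
  then show thesis
    using that[of "(1 / q v) *\<^sub>R v"] v V norm_onD(3)[OF q v(1), of "1 / q v"] by (simp add: subspace_scale)
qed

text \<open>\<open>Lim\<close> is a mere description, so the limit must be shown to exist. The norm
  of \<open>mat 1 + t *\<^sub>R A\<close> is convex in \<open>t\<close> with value 1 at 0, which
  makes the quotients monotone. A unit vector bounds them below and keeps the set under the supremum
  nonempty; hence \<open>V \<noteq> {0}\<close>.\<close>

lemma matrix_measure_tendsto: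
  fixes A :: "real ^ 'b ^ 'b"
  assumes p: "norm_on V p" and V: "subspace V" "V \<noteq> {0}" and A: "\<And>v. v \<in> V \<Longrightarrow> A *v v \<in> V"
  shows "((\<lambda>t. (mixed_norm V p p (mat 1 + t *\<^sub>R A) - 1) / t) \<longlongrightarrow> matrix_measure V p A) (at_right 0)"
proof -
  define F where "F t = mixed_norm V p p (mat 1 + t *\<^sub>R A)" for t
  have app: "(mat 1 + t *\<^sub>R A) *v v = v + t *\<^sub>R (A *v v)" for t v
    by (simp add: matrix_vector_mult_add_rdistrib scaleR_matrix_vector_assoc)
  have inv: "(mat 1 + t *\<^sub>R A) *v v \<in> V" if "v \<in> V" for t v
    using that A V(1) by (simp add: app subspace_add subspace_scale)
  obtain u where u: "u \<in> V" "p u = 1" using norm_on_unit_vector[OF p V] by blast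
  have F: "p (v + t *\<^sub>R (A *v v)) \<le> F t * p v" if "v \<in> V" for v t
    using mixed_norm_bound[OF p V(1) p V(1) inv that, of t] by (simp add: app F_def)
  have mono: "(F s - 1) / s \<le> (F t - 1) / t" if st: "0 < s" "s \<le> t" for s t
  proof -
    have "F s \<le> (1 - s / t) + s / t * F t"
      unfolding F_def[of s] mixed_norm_def
    proof (rule cSUP_least)
      show "{v \<in> V. p v = 1} \<noteq> {}" using u by blast
      fix v assume v: "v \<in> {v \<in> V. p v = 1}"
      have w: "v + t *\<^sub>R (A *v v) \<in> V" using inv[of v t] v by (simp add: app)
      have "v + s *\<^sub>R (A *v v) = (1 - s / t) *\<^sub>R v + (s / t) *\<^sub>R (v + t *\<^sub>R (A *v v))"
        using st by (simp add: algebra_simps)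
      then have "p ((mat 1 + s *\<^sub>R A) *v v) \<le> p ((1 - s / t) *\<^sub>R v) + p ((s / t) *\<^sub>R (v + t *\<^sub>R (A *v v)))"
        using norm_onD(4)[OF p, of "(1 - s / t) *\<^sub>R v" "(s / t) *\<^sub>R (v + t *\<^sub>R (A *v v))"] v w V(1)
        by (simp add: app subspace_scale)
      also have "\<dots> = (1 - s / t) + (s / t) * p (v + t *\<^sub>R (A *v v))"
        using norm_onD(3)[OF p] v w st by simp
      also have "\<dots> \<le> (1 - s / t) + (s / t) * F t"
        using F[of v t] v st by (intro add_left_mono mult_left_mono) auto
      finally show "p ((mat 1 + s *\<^sub>R A) *v v) \<le> 1 - s / t + s / t * F t" .
    qed
    also have "\<dots> = 1 + s * ((F t - 1) / t)" using st by (simp add: field_simps)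
    finally have "F s - 1 \<le> ((F t - 1) / t) * s" by (simp only: mult.commute le_diff_eq diff_le_eq add.commute)
    then show ?thesis using st by (simp only: pos_divide_le_eq)
  qed
  have low: "- p (A *v u) \<le> (F t - 1) / t" if t: "0 < t" for t
  proof -
    have Au: "A *v u \<in> V" using A u by blast
    have "p u \<le> p (u + t *\<^sub>R (A *v u)) + p ((- t) *\<^sub>R (A *v u))"
      using norm_onD(4)[OF p, of "u + t *\<^sub>R (A *v u)" "(- t) *\<^sub>R (A *v u)"] V(1) Au u(1)
      by (simp add: subspace_add subspace_scale subspace_neg)
    then have "1 \<le> F t + t * p (A *v u)"
      using F[OF u(1), of t] norm_onD(3)[OF p Au, of "- t"] t u(2) by simp
    then show ?thesis using t by (simp add: field_simps)
  qed
  have lim: "((\<lambda>t. (F t - 1) / t) \<longlongrightarrow> Inf ((\<lambda>t. (F t - 1) / t) ` {0<..})) (at_right 0)"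
    by (rule mono_tendsto_at_right_0[OF mono low])
  have "matrix_measure V p A = Inf ((\<lambda>t. (F t - 1) / t) ` {0<..})"
    unfolding matrix_measure_def F_def[symmetric]
    by (rule tendsto_Lim[OF trivial_limit_at_right_real lim])
  then show ?thesis using lim by (simp only: F_def)
qed

text \<open>Turns a limit of operator norms into an estimate for one \<open>h\<close> and all
  \<open>v\<close> at once; the strict inequality for \<open>c\<close> leaves the room.\<close>

lemma matrix_measure_bound:
  fixes A :: "real ^ 'b ^ 'b"
  assumes p: "norm_on V p" and V: "subspace V" "V \<noteq> {0}" and A: "\<And>v. v \<in> V \<Longrightarrow> A *v v \<in> V"
    and c: "matrix_measure V p A < c"
  shows "eventually (\<lambda>h. \<forall>v\<in>V. p (v + h *\<^sub>R (A *v v)) \<le> (1 + h * c) * p v) (at_right 0)"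
proof -
  have "eventually (\<lambda>h. (mixed_norm V p p (mat 1 + h *\<^sub>R A) - 1) / h < c) (at_right 0)"
    using order_tendstoD(2)[OF matrix_measure_tendsto[OF p V A] c] .
  moreover have "eventually (\<lambda>h::real. h > 0) (at_right 0)" by (simp add: eventually_at_right_less)
  ultimately show ?thesis
  proof eventually_elim
    fix h :: real assume h: "(mixed_norm V p p (mat 1 + h *\<^sub>R A) - 1) / h < c" "h > 0"
    show "\<forall>v\<in>V. p (v + h *\<^sub>R (A *v v)) \<le> (1 + h * c) * p v"
    proof
      fix v assume v: "v \<in> V"
      have app: "(mat 1 + h *\<^sub>R A) *v v = v + h *\<^sub>R (A *v v)" for v
        by (simp add: matrix_vector_mult_add_rdistrib scaleR_matrix_vector_assoc)
      have "p (v + h *\<^sub>R (A *v v)) \<le> mixed_norm V p p (mat 1 + h *\<^sub>R A) * p v"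
        using mixed_norm_bound[OF p V(1) p V(1) _ v, of "mat 1 + h *\<^sub>R A"] A V(1)
        by (simp add: app subspace_add subspace_scale)
      also have "\<dots> \<le> (1 + h * c) * p v"
        using h norm_onD(1)[OF p v] by (intro mult_right_mono) (auto simp: field_simps)
      finally show "p (v + h *\<^sub>R (A *v v)) \<le> (1 + h * c) * p v" .
    qed
  qed
qed

section \<open>The norm composed from the local norms and the network norm\<close>

lemma subspace_block_space: "subspace (block_space blk i)"
  by (auto simp: subspace_def block_space_def)

lemma block_space_nontrivial:
  fixes blk :: "'n::finite \<Rightarrow> 'm"
  assumes "surj blk"
  shows "block_space blk i \<noteq> {0}"
proof -
  obtain k where k: "blk k = i" using assms by (metis surjD)
  have "axis k 1 \<in> block_space blk i" using k by (auto simp: block_space_def axis_def)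
  moreover have "axis k (1::real) \<noteq> 0" by (simp add: axis_eq_0_iff)
  ultimately show ?thesis by blast
qed

definition block_proj :: "('n \<Rightarrow> 'm) \<Rightarrow> 'm \<Rightarrow> real ^ 'n \<Rightarrow> real ^ 'n" where
  "block_proj blk i x = (\<chi> k. if blk k = i then x $ k else 0)"

definition block_norm ::
  "('n \<Rightarrow> 'm) \<Rightarrow> ('m \<Rightarrow> real ^ 'n \<Rightarrow> real) \<Rightarrow> (real ^ 'm \<Rightarrow> real) \<Rightarrow> real ^ 'n \<Rightarrow> real" where
  "block_norm blk lnrm nnrm x = nnrm (\<chi> i. lnrm i (block_proj blk i x))"

lemma block_proj_in: "block_proj blk i x \<in> block_space blk i"
  by (simp add: block_proj_def block_space_def)

lemma block_proj_add: "block_proj blk i (x + y) = block_proj blk i x + block_proj blk i y"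
  by (auto simp: block_proj_def vec_eq_iff)

lemma block_proj_scaleR: "block_proj blk i (c *\<^sub>R x) = c *\<^sub>R block_proj blk i x"
  by (auto simp: block_proj_def vec_eq_iff)

text \<open>Monotonicity of the network norm is what gives the triangle inequality: the vector of
  local norms of \<open>x + y\<close> is only entrywise below the sum of the two vectors.\<close>

lemma norm_on_block_norm:
  fixes blk :: "'n::finite \<Rightarrow> 'm::finite"
  assumes l: "\<And>i. norm_on (block_space blk i) (lnrm i)" and p: "norm_on UNIV nnrm"
    and mono: "monotone_norm nnrm"
  shows "norm_on UNIV (block_norm blk lnrm nnrm)"
proof -
  have nn: "0 \<le> lnrm i (block_proj blk i x)" for i x
    using norm_onD(1)[OF l block_proj_in] .
  have zero: "block_norm blk lnrm nnrm x = 0 \<longleftrightarrow> x = 0" for x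
  proof -
    have "block_norm blk lnrm nnrm x = 0 \<longleftrightarrow> (\<forall>i. block_proj blk i x = 0)"
      using norm_onD(2)[OF p] norm_onD(2)[OF l block_proj_in]
      by (simp add: block_norm_def vec_eq_iff[of "vec_lambda _"])
    also have "\<dots> \<longleftrightarrow> x = 0" by (auto simp: block_proj_def vec_eq_iff)
    finally show ?thesis .
  qed
  have scale: "block_norm blk lnrm nnrm (c *\<^sub>R x) = \<bar>c\<bar> * block_norm blk lnrm nnrm x" for c x
  proof -
    have "(\<chi> i. lnrm i (block_proj blk i (c *\<^sub>R x))) = \<bar>c\<bar> *\<^sub>R (\<chi> i. lnrm i (block_proj blk i x))"
      by (simp add: vec_eq_iff block_proj_scaleR norm_onD(3)[OF l block_proj_in])
    then show ?thesis using norm_onD(3)[OF p] by (simp add: block_norm_def)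
  qed
  have tri: "block_norm blk lnrm nnrm (x + y) \<le> block_norm blk lnrm nnrm x + block_norm blk lnrm nnrm y" for x y
  proof -
    have "block_norm blk lnrm nnrm (x + y)
        \<le> nnrm ((\<chi> i. lnrm i (block_proj blk i x)) + (\<chi> i. lnrm i (block_proj blk i y)))"
      unfolding block_norm_def
    proof (rule mono[unfolded monotone_norm_def, rule_format])
      show "0 \<le> (\<chi> i. lnrm i (block_proj blk i (x + y))) $ i" for i by (simp add: nn)
      show "(\<chi> i. lnrm i (block_proj blk i (x + y))) $ i
          \<le> ((\<chi> i. lnrm i (block_proj blk i x)) + (\<chi> i. lnrm i (block_proj blk i y))) $ i" for i
        using norm_onD(4)[OF l block_proj_in block_proj_in] by (simp add: block_proj_add)
    qed
    also have "\<dots> \<le> block_norm blk lnrm nnrm x + block_norm blk lnrm nnrm y"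
      unfolding block_norm_def using norm_onD(4)[OF p] by simp
    finally show ?thesis .
  qed
  show ?thesis
    unfolding norm_on_def
    using zero scale tri norm_onD(1)[OF p] by (auto simp: block_norm_def)
qed

lemma block_jacobian_mult_in:
  "block_jacobian blk i j g x *v v \<in> block_space blk i"
  by (simp add: block_space_def block_jacobian_def matrix_vector_mult_def)

text \<open>Block multiplication: each column \<open>l\<close> lies in the single block
  \<open>blk l\<close>, so after exchanging the sums the sum over \<open>j\<close> has one nonzero
  term.\<close>

lemma block_proj_jacobian_mult:
  fixes blk :: "'n::finite \<Rightarrow> 'm::finite"
  shows "block_proj blk i (jacobian g (at x) *v v)
    = (\<Sum>j\<in>UNIV. block_jacobian blk i j g x *v block_proj blk j v)"
proof -
  have "(\<Sum>j\<in>UNIV. \<Sum>l\<in>UNIV. (if blk k = i \<and> blk l = j then jacobian g (at x) $ k $ l else 0)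
            * (if blk l = j then v $ l else 0))
        = (if blk k = i then \<Sum>l\<in>UNIV. jacobian g (at x) $ k $ l * v $ l else 0)" for k
  proof -
    have "(\<Sum>j\<in>UNIV. \<Sum>l\<in>UNIV. (if blk k = i \<and> blk l = j then jacobian g (at x) $ k $ l else 0)
            * (if blk l = j then v $ l else 0))
        = (\<Sum>l\<in>UNIV. \<Sum>j\<in>UNIV. if blk l = j then (if blk k = i then jacobian g (at x) $ k $ l * v $ l else 0) else 0)"
      by (subst sum.swap) (auto intro!: sum.cong)
    also have "\<dots> = (if blk k = i then \<Sum>l\<in>UNIV. jacobian g (at x) $ k $ l * v $ l else 0)"
      by simp
    finally show ?thesis .
  qed
  then show ?thesis
    by (simp add: vec_eq_iff block_proj_def block_jacobian_def matrix_vector_mult_def)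
qed

text \<open>For small \<open>h\<close> the vector of local norms of \<open>z + h J z\<close> is bounded entrywise by
  \<open>I + h A\<^sub>N + h e I\<close> applied to that of \<open>z\<close>.\<close>
lemma block_norm_dd_le:
  fixes blk :: "'n::finite \<Rightarrow> 'm::finite"
  assumes surj: "surj blk"
    and l: "\<And>i. norm_on (block_space blk i) (lnrm i)" and p: "norm_on UNIV nnrm"
    and mono: "monotone_norm nnrm"
    and c: "matrix_measure UNIV nnrm (interconnection_matrix blk lnrm f t x) \<le> c"
  shows "norm_dd (block_norm blk lnrm nnrm) z (jacobian (f t) (at x) *v z) \<le> c * block_norm blk lnrm nnrm z"
proof (rule norm_dd_le[OF norm_on_block_norm[OF l p mono]])
  fix e :: real assume e: "e > 0"
  define A where "A = interconnection_matrix blk lnrm f t x"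
  define B where "B i j = block_jacobian blk i j (f t) x" for i j
  define zv :: "real ^ 'm" where "zv = (\<chi> i. lnrm i (block_proj blk i z))"
  have sub: "subspace (block_space blk i)" for i by (rule subspace_block_space)
  have nt: "block_space blk i \<noteq> {0}" for i by (rule block_space_nontrivial[OF surj])
  have Bin: "B i j *v v \<in> block_space blk i" for i j v
    unfolding B_def by (rule block_jacobian_mult_in)
  have zv0: "0 \<le> zv $ i" for i using norm_onD(1)[OF l block_proj_in] by (simp add: zv_def)
  \<comment> \<open>Half of the slack \<open>e\<close> is spent on the local measures and half on
    the network measure. There are finitely many blocks, so one \<open>h\<close> serves all of
    them.\<close>
  have "eventually (\<lambda>h. \<forall>i. \<forall>v\<in>block_space blk i.
      lnrm i (v + h *\<^sub>R (B i i *v v)) \<le> (1 + h * (A $ i $ i + e / 2)) * lnrm i v) (at_right 0)"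
  proof (rule eventually_all_finite)
    fix i
    show "eventually (\<lambda>h. \<forall>v\<in>block_space blk i.
      lnrm i (v + h *\<^sub>R (B i i *v v)) \<le> (1 + h * (A $ i $ i + e / 2)) * lnrm i v) (at_right 0)"
      by (rule matrix_measure_bound[OF l sub nt Bin])
         (use e in \<open>simp add: A_def B_def interconnection_matrix_def\<close>)
  qed
  moreover have "eventually (\<lambda>h. \<forall>v\<in>UNIV. nnrm (v + h *\<^sub>R (A *v v)) \<le> (1 + h * (c + e / 2)) * nnrm v) (at_right 0)"
  proof (rule matrix_measure_bound[OF p subspace_UNIV])
    show "(UNIV :: (real ^ 'm) set) \<noteq> {0}"
      by (metis UNIV_not_singleton)
    show "matrix_measure UNIV nnrm A < c + e / 2" using c e by (simp add: A_def)
  qed simp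
  moreover have "eventually (\<lambda>h::real. h > 0) (at_right 0)" by (simp add: eventually_at_right_less)
  ultimately have "eventually (\<lambda>h. h > 0 \<and> block_norm blk lnrm nnrm (z + h *\<^sub>R (jacobian (f t) (at x) *v z))
      \<le> (1 + h * (c + e)) * block_norm blk lnrm nnrm z) (at_right 0)"
  proof eventually_elim
    fix h :: real
    assume h1: "\<forall>i. \<forall>v\<in>block_space blk i.
        lnrm i (v + h *\<^sub>R (B i i *v v)) \<le> (1 + h * (A $ i $ i + e / 2)) * lnrm i v"
      and h2: "\<forall>v\<in>UNIV. nnrm (v + h *\<^sub>R (A *v v)) \<le> (1 + h * (c + e / 2)) * nnrm v" and h: "0 < h"
    let ?w = "z + h *\<^sub>R (jacobian (f t) (at x) *v z)"
    have entry: "lnrm i (block_proj blk i ?w) \<le> (zv + h *\<^sub>R (A *v zv) + (h * (e / 2)) *\<^sub>R zv) $ i" for i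
    proof -
      let ?zi = "block_proj blk i z"
      let ?r = "\<Sum>j\<in>UNIV - {i}. h *\<^sub>R (B i j *v block_proj blk j z)"
      have "block_proj blk i ?w = (?zi + h *\<^sub>R (B i i *v ?zi)) + ?r"
        by (simp add: block_proj_add block_proj_scaleR block_proj_jacobian_mult B_def[symmetric]
            sum.remove[of UNIV i] scaleR_sum_right scaleR_add_right)
      moreover have "?zi + h *\<^sub>R (B i i *v ?zi) \<in> block_space blk i"
        by (intro subspace_add[OF sub] subspace_scale[OF sub] block_proj_in Bin)
      moreover have "?r \<in> block_space blk i"
        by (intro subspace_sum[OF sub] subspace_scale[OF sub] Bin)
      ultimately have "lnrm i (block_proj blk i ?w) \<le> lnrm i (?zi + h *\<^sub>R (B i i *v ?zi)) + lnrm i ?r"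
        using norm_onD(4)[OF l] by simp
      also have "lnrm i (?zi + h *\<^sub>R (B i i *v ?zi)) \<le> (1 + h * (A $ i $ i + e / 2)) * zv $ i"
        using h1[rule_format, OF block_proj_in[of blk i z]] by (simp add: zv_def)
      also have "lnrm i ?r \<le> (\<Sum>j\<in>UNIV - {i}. lnrm i (h *\<^sub>R (B i j *v block_proj blk j z)))"
        by (rule norm_on_sum[OF l sub]) (use sub Bin in \<open>auto simp: subspace_scale\<close>)
      also have "\<dots> \<le> (\<Sum>j\<in>UNIV - {i}. h * (A $ i $ j * zv $ j))"
      proof (rule sum_mono)
        fix j assume j: "j \<in> UNIV - {i}"
        have "lnrm i (B i j *v block_proj blk j z) \<le> mixed_norm (block_space blk j) (lnrm j) (lnrm i) (B i j) * zv $ j"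
          unfolding zv_def vec_lambda_beta by (rule mixed_norm_bound[OF l sub l sub Bin block_proj_in])
        also have "mixed_norm (block_space blk j) (lnrm j) (lnrm i) (B i j) = A $ i $ j"
          using j by (simp add: A_def B_def interconnection_matrix_def)
        finally show "lnrm i (h *\<^sub>R (B i j *v block_proj blk j z)) \<le> h * (A $ i $ j * zv $ j)"
          using h norm_onD(3)[OF l Bin] by simp
      qed
      finally have "lnrm i (block_proj blk i ?w)
          \<le> (1 + h * (A $ i $ i + e / 2)) * zv $ i + (\<Sum>j\<in>UNIV - {i}. h * (A $ i $ j * zv $ j))"
        by simp
      also have "\<dots> = (zv + h *\<^sub>R (A *v zv) + (h * (e / 2)) *\<^sub>R zv) $ i"
        by (simp add: matrix_vector_mult_def sum.remove[of UNIV i] sum_distrib_left algebra_simps)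
      finally show ?thesis .
    qed
    \<comment> \<open>Local norms are nonnegative, so monotonicity lifts the entrywise bound
      \<open>entry\<close> to the network norm.\<close>
    have "block_norm blk lnrm nnrm ?w \<le> nnrm (zv + h *\<^sub>R (A *v zv) + (h * (e / 2)) *\<^sub>R zv)"
      unfolding block_norm_def
      using mono[unfolded monotone_norm_def, rule_format] entry norm_onD(1)[OF l block_proj_in] by simp
    also have "\<dots> \<le> nnrm (zv + h *\<^sub>R (A *v zv)) + h * (e / 2) * nnrm zv"
      using norm_onD(4)[OF p, of "zv + h *\<^sub>R (A *v zv)" "(h * (e / 2)) *\<^sub>R zv"]
        norm_onD(3)[OF p, of zv "h * (e / 2)"] h e by simp
    also have "\<dots> \<le> (1 + h * (c + e / 2)) * nnrm zv + h * (e / 2) * nnrm zv"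
      using h2 by simp
    also have "\<dots> = (1 + h * (c + e)) * block_norm blk lnrm nnrm z"
      by (simp add: block_norm_def zv_def algebra_simps)
    finally show "h > 0 \<and> block_norm blk lnrm nnrm ?w \<le> (1 + h * (c + e)) * block_norm blk lnrm nnrm z"
      using h by simp
  qed
  then show "\<exists>h>0. block_norm blk lnrm nnrm (z + h *\<^sub>R (jacobian (f t) (at x) *v z))
      \<le> (1 + h * (c + e)) * block_norm blk lnrm nnrm z"
    by (rule eventually_happens'[OF trivial_limit_at_right_real])
qed

section \<open>Integration of one-sided derivatives\<close>

lemma negligible_countable_real: "countable N \<Longrightarrow> negligible (N :: real set)"
  by (simp add: negligible_iff_null_sets countable_imp_null_set_lborel null_sets_completionI)

lemma right_quotient_sequence:
  fixes \<phi> :: "real \<Rightarrow> real"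
  assumes "(\<phi> has_real_derivative D) (at_right t)"
  shows "(\<lambda>j. real (Suc j) * (\<phi> (t + 1 / real (Suc j)) - \<phi> t)) \<longlonglongrightarrow> D"
proof -
  have lim: "((\<lambda>y. (\<phi> y - \<phi> t) / (y - t)) \<longlongrightarrow> D) (at_right t)"
    using assms by (simp add: has_field_derivative_iff)
  have "filterlim (\<lambda>j. t + 1 / real (Suc j)) (at_right t) sequentially"
  proof -
    have "(\<lambda>j. t + 1 / real (Suc j)) \<longlonglongrightarrow> t + 0"
      by (intro tendsto_add tendsto_const lim_1_over_n[THEN LIMSEQ_Suc])
    then show ?thesis by (auto simp: filterlim_at)
  qed
  from filterlim_compose[OF lim this] show ?thesis by (simp add: mult.commute)
qed

text \<open>The difference quotients with step \<open>1 / (j + 1)\<close> are bounded and converge to the right derivative,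
  while their integrals telescope to the increment of \<open>\<phi>\<close>.\<close>
lemma right_derivative_has_integral:
  fixes \<phi> m :: "real \<Rightarrow> real"
  assumes ab: "a \<le> b" and lip: "L-lipschitz_on {a..b + 1} \<phi>" and N: "countable N"
    and der: "\<And>t. t \<in> {a..b} - N \<Longrightarrow> (\<phi> has_real_derivative m t) (at_right t)"
  shows "(m has_integral (\<phi> b - \<phi> a)) {a..b}"
proof -
  note neg = negligible_countable_real[OF N]
  define h where "h j = 1 / real (Suc j)" for j
  \<comment> \<open>Steps of at most 1 keep \<open>t + h j\<close> in \<open>{a..b + 1}\<close>;
    this is why the Lipschitz bound reaches beyond \<open>b\<close>.\<close>
  have h: "0 < h j" "h j \<le> 1" for j by (auto simp: h_def)
  have cont: "continuous_on {a..b + 1} \<phi>" using lip by (rule lipschitz_on_continuous_on)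
  have int: "\<phi> integrable_on {a..b + 1}" using cont by (rule integrable_continuous_real)
  define \<Phi> where "\<Phi> t = integral {a..t} \<phi>" for t
  have \<Phi>der: "(\<Phi> has_real_derivative \<phi> t) (at_right t)" if t: "t \<in> {a..b}" for t
  proof -
    have "(\<Phi> has_real_derivative \<phi> t) (at t within {a..b + 1})"
      unfolding \<Phi>_def using integral_has_real_derivative[OF cont, of t] t by simp
    then have "(\<Phi> has_real_derivative \<phi> t) (at t within {t..b + 1})"
      by (rule has_field_derivative_subset) (use t in auto)
    moreover have "at t within {t..b + 1} = at_right t"
      using at_within_Icc_at_right[of t "b + 1"] t by simp
    ultimately show ?thesis by simp
  qed
  define q where "q j t = real (Suc j) * (\<phi> (t + h j) - \<phi> t)" for j t
  have shiftc: "continuous_on {a..b} (\<lambda>t. \<phi> (t + h j))" for j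
    by (rule continuous_on_compose2[OF cont]) (use h[of j] in \<open>auto intro!: continuous_intros\<close>)
  have contb: "continuous_on {a..b} \<phi>" using cont by (rule continuous_on_subset) auto
  have qint: "q j integrable_on {a..b}" for j
    unfolding q_def using shiftc contb by (intro integrable_continuous_real continuous_intros)
  have qbound: "norm (q j t) \<le> L" if "t \<in> {a..b}" for j t
  proof -
    have "dist (\<phi> (t + h j)) (\<phi> t) \<le> L * dist (t + h j) t"
      by (rule lipschitz_onD[OF lip]) (use that h[of j] in auto)
    then have "\<bar>\<phi> (t + h j) - \<phi> t\<bar> \<le> L * h j" using h[of j] by (simp add: dist_real_def)
    then have "real (Suc j) * \<bar>\<phi> (t + h j) - \<phi> t\<bar> \<le> real (Suc j) * (L * h j)"
      by (intro mult_left_mono) auto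
    also have "\<dots> = L" by (simp add: h_def del: of_nat_Suc)
    finally show ?thesis by (simp only: q_def real_norm_def abs_mult abs_of_nat)
  qed
  have L: "0 \<le> L" using lip lipschitz_on_nonneg by blast
  \<comment> \<open>After the shift only the pieces of length \<open>h j\<close> at the two ends
    survive. Each is a right difference quotient of the antiderivative \<open>\<Phi>\<close>, with
    limits \<open>\<phi> b\<close> and \<open>\<phi> a\<close>.\<close>
  have qval: "integral {a..b} (q j)
      = real (Suc j) * (\<Phi> (b + h j) - \<Phi> b) - real (Suc j) * (\<Phi> (a + h j) - \<Phi> a)" for j
  proof -
    have "integral {a..b} (\<lambda>t. \<phi> (t + h j)) = integral {a + h j..b + h j} \<phi>"
      using integral_shift_real_ivl[of "a + h j" "h j" "b + h j" \<phi>] by simp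
    moreover have "\<Phi> (a + h j) + integral {a + h j..b + h j} \<phi> = \<Phi> (b + h j)"
      unfolding \<Phi>_def
      by (rule Henstock_Kurzweil_Integration.integral_combine)
         (use h[of j] ab in \<open>auto intro: integrable_subinterval_real[OF int]\<close>)
    then have "integral {a + h j..b + h j} \<phi> = \<Phi> (b + h j) - \<Phi> (a + h j)" by simp
    moreover have "integral {a..b} (q j)
        = real (Suc j) * (integral {a..b} (\<lambda>t. \<phi> (t + h j)) - integral {a..b} \<phi>)"
      unfolding q_def
      using integrable_continuous_real[OF shiftc[of j]] integrable_continuous_real[OF contb]
      by (simp add: integral_diff)
    moreover have "\<Phi> a = 0" by (simp add: \<Phi>_def)
    ultimately have "integral {a..b} (q j) = real (Suc j) * ((\<Phi> (b + h j) - \<Phi> (a + h j)) - (\<Phi> b - \<Phi> a))"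
      by (simp add: \<Phi>_def[of b])
    then show ?thesis by (simp only: right_diff_distrib)
  qed
  have lim: "(\<lambda>j. integral {a..b} (q j)) \<longlonglongrightarrow> \<phi> b - \<phi> a"
    unfolding qval h_def
    by (intro tendsto_diff right_quotient_sequence \<Phi>der) (use ab in auto)
  \<comment> \<open>On \<open>N\<close> no limit is known. Both sides are set to 0 there, as
    \<open>dominated_convergence\<close> asks for convergence at every point.\<close>
  define q' where "q' j t = (if t \<in> N then 0 else q j t)" for j t
  define m' where "m' t = (if t \<in> N then 0 else m t)" for t
  have q'int: "q' j integrable_on {a..b}" for j
    by (rule integrable_spike[OF qint[of j] neg]) (auto simp: q'_def)
  have q'eq: "integral {a..b} (q' j) = integral {a..b} (q j)" for j
    by (rule integral_spike[OF neg]) (auto simp: q'_def)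
  have conv: "(\<lambda>j. q' j t) \<longlonglongrightarrow> m' t" if "t \<in> {a..b}" for t
    using right_quotient_sequence[OF der, of t] that
    by (cases "t \<in> N") (auto simp: q'_def m'_def q_def h_def)
  have bd: "norm (q' j t) \<le> L" if "t \<in> {a..b}" for j t
    using qbound[OF that] L by (simp add: q'_def)
  note dc = dominated_convergence[OF q'int integrable_const_ivl bd conv]
  have "integral {a..b} m' = \<phi> b - \<phi> a"
    using LIMSEQ_unique[OF dc(2)] lim by (simp add: q'eq)
  then have "(m' has_integral (\<phi> b - \<phi> a)) {a..b}"
    using dc(1) by (metis integrable_integral)
  then show ?thesis
    by (rule has_integral_spike[OF neg, rotated]) (auto simp: m'_def)
qed

text \<open>A one-sided dominated convergence: \<open>m k\<close> itself need not converge and may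
  stay below 0, but its positive part is squeezed between 0 and
  \<open>max (e k t) 0\<close>.\<close>

lemma integral_eventually_le:
  fixes m e :: "nat \<Rightarrow> real \<Rightarrow> real"
  assumes N: "countable N" and int: "\<And>k. m k integrable_on {a..b}"
    and bound: "\<And>k t. t \<in> {a..b} - N \<Longrightarrow> \<bar>m k t\<bar> \<le> B"
    and le: "\<And>k t. t \<in> {a..b} - N \<Longrightarrow> m k t \<le> e k t"
    and e: "\<And>t. t \<in> {a..b} - N \<Longrightarrow> (\<lambda>k. e k t) \<longlonglongrightarrow> 0"
    and \<epsilon>: "\<epsilon> > 0"
  shows "eventually (\<lambda>k. integral {a..b} (m k) \<le> \<epsilon>) sequentially"
proof -
  note neg = negligible_countable_real[OF N]
  define m0 where "m0 k t = (if t \<in> N then 0 else m k t)" for k t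
  define m' where "m' k t = max (m0 k t) 0" for k t
  have m0int: "m0 k integrable_on {a..b}" for k
    by (rule integrable_spike[OF int[of k] neg]) (auto simp: m0_def)
  have "norm (m0 k t) \<le> \<bar>B\<bar>" if "t \<in> {a..b}" for k t
    using bound[of t k] that by (auto simp: m0_def)
  \<comment> \<open>Taking the maximum with 0 is safe for absolutely integrable functions; the bound
    \<open>B\<close> provides this.\<close>
  then have "m0 k absolutely_integrable_on {a..b}" for k
    by (rule absolutely_integrable_integrable_bound[OF _ m0int integrable_const_ivl])
  then have "m' k absolutely_integrable_on {a..b}" for k
    unfolding m'_def by (intro absolutely_integrable_max_1) auto
  then have m'int: "m' k integrable_on {a..b}" for k
    using absolutely_integrable_on_def by blast
  have conv: "(\<lambda>k. m' k t) \<longlonglongrightarrow> 0" if "t \<in> {a..b}" for t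
  proof (cases "t \<in> N")
    case True
    then show ?thesis by (simp add: m'_def m0_def)
  next
    case False
    have "(\<lambda>k. max (e k t) 0) \<longlonglongrightarrow> max 0 0"
      using e[of t] that False by (intro tendsto_max tendsto_const) auto
    then have "(\<lambda>k. max (e k t) 0) \<longlonglongrightarrow> 0" by simp
    then show ?thesis
    proof (rule Lim_null_comparison[rotated])
      show "eventually (\<lambda>k. norm (m' k t) \<le> max (e k t) 0) sequentially"
        using le[of t] that False
        by (intro always_eventually) (auto simp: m'_def m0_def intro: max.coboundedI1)
    qed
  qed
  have bd: "norm (m' k t) \<le> \<bar>B\<bar>" if "t \<in> {a..b}" for k t
    using bound[of t k] that by (auto simp: m'_def m0_def)
  have "(\<lambda>k. integral {a..b} (m' k)) \<longlonglongrightarrow> integral {a..b} (\<lambda>t. 0)"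
    by (rule dominated_convergence(2)[OF m'int integrable_const_ivl bd conv])
  then have "eventually (\<lambda>k. integral {a..b} (m' k) < \<epsilon>) sequentially"
    using order_tendstoD(2) \<epsilon> by fastforce
  moreover have "integral {a..b} (m k) \<le> integral {a..b} (m' k)" for k
  proof -
    have "integral {a..b} (m k) = integral {a..b} (m0 k)"
      by (rule integral_spike[OF neg]) (auto simp: m0_def)
    also have "\<dots> \<le> integral {a..b} (m' k)"
      by (rule integral_le[OF m0int m'int]) (auto simp: m'_def)
    finally show ?thesis .
  qed
  ultimately show ?thesis
    by (auto elim!: eventually_mono intro: order_trans less_imp_le)
qed

text \<open>Let \<open>W\<close> be the right-hand side of the hypothesis. Its derivative
  \<open>L * w\<close> is at most \<open>L * W\<close>, so \<open>V\<close>, which is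
  \<open>W\<close> damped at rate \<open>L\<close>, does not increase from its initial value
  \<open>A\<close>.\<close>

lemma gronwall_integral:
  fixes w :: "real \<Rightarrow> real"
  assumes cont: "continuous_on {a..b} w" and L: "0 \<le> L"
    and le: "\<And>t. t \<in> {a..b} \<Longrightarrow> w t \<le> A + L * integral {a..t} w"
    and t: "t \<in> {a..b}"
  shows "w t \<le> A * exp (L * (t - a))"
proof -
  define W where "W s = A + L * integral {a..s} w" for s
  define V where "V s = W s * exp (- L * (s - a))" for s
  have Wd: "(W has_real_derivative L * w s) (at s within {a..b})" if "s \<in> {a..b}" for s
    unfolding W_def
    by (rule derivative_eq_intros integral_has_real_derivative[OF cont that] refl | simp)+
  have "V a \<ge> V t"
  proof (rule DERIV_nonpos_imp_decreasing_open[where f = V and a = a and b = t])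
    show "a \<le> t" using t by simp
    fix s assume s: "a < s" "s < t"
    then have sab: "s \<in> {a..b}" using t by simp
    have "at s within {a..b} = at s"
      by (rule at_within_interior) (use s t in auto)
    then have Ws: "(W has_real_derivative L * w s) (at s)" using Wd[OF sab] by simp
    have "(V has_real_derivative (L * w s - L * W s) * exp (- L * (s - a))) (at s)"
      unfolding V_def by (auto intro!: derivative_eq_intros Ws simp: algebra_simps)
    moreover have "(L * w s - L * W s) * exp (- L * (s - a)) \<le> 0"
    proof (rule mult_nonpos_nonneg)
      show "L * w s - L * W s \<le> 0" using le[OF sab] L by (simp add: W_def mult_left_mono)
    qed simp
    ultimately show "\<exists>y. (V has_real_derivative y) (at s) \<and> y \<le> 0" by blast
  next
    have "continuous_on {a..b} W" by (rule DERIV_continuous_on[OF Wd])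
    then have "continuous_on {a..t} W" by (rule continuous_on_subset) (use t in auto)
    then show "continuous_on {a..t} V" unfolding V_def by (intro continuous_intros)
  qed
  then have "W t * exp (- L * (t - a)) \<le> A" by (simp add: V_def W_def)
  then have "(W t * exp (- L * (t - a))) * exp (L * (t - a)) \<le> A * exp (L * (t - a))"
    by (rule mult_right_mono) simp
  then have "W t \<le> A * exp (L * (t - a))" by (simp add: mult.assoc exp_add[symmetric])
  then show ?thesis using le[OF t] by (simp add: W_def)
qed

section \<open>The flow of a Caratheodory system\<close>

lemma solves_from_init:
  assumes "solves_from f s x u"
  shows "u s = x"
proof -
  have "((\<lambda>\<tau>. f \<tau> (u \<tau>)) has_integral (u s - x)) {s..s}"
    using assms[unfolded solves_from_def, rule_format, OF order_refl] .
  then have "u s - x = 0"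
    by (rule has_integral_unique) (use has_integral_refl(2)[of _ s] in simp)
  then show ?thesis by simp
qed

lemma solves_from_eq:
  assumes "solves_from f s x u" "s \<le> t"
  shows "u t = x + integral {s..t} (\<lambda>\<tau>. f \<tau> (u \<tau>))"
proof -
  have "integral {s..t} (\<lambda>\<tau>. f \<tau> (u \<tau>)) = u t - x"
    by (rule integral_unique[OF assms(1)[unfolded solves_from_def, rule_format, OF assms(2)]])
  then show ?thesis by simp
qed

lemma solves_from_integrable:
  assumes "solves_from f s x u" "s \<le> a"
  shows "(\<lambda>\<tau>. f \<tau> (u \<tau>)) integrable_on {a..b}"
proof (cases "a \<le> b")
  case True
  then have "(\<lambda>\<tau>. f \<tau> (u \<tau>)) integrable_on {s..b}"
    using assms unfolding solves_from_def by (meson has_integral_integrable order_trans)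
  then show ?thesis by (rule integrable_subinterval_real) (use assms in auto)
qed auto

lemma solves_from_continuous_on:
  assumes "solves_from f s x u"
  shows "continuous_on {s..b} u"
proof -
  have "continuous_on {s..b} (\<lambda>t. x + integral {s..t} (\<lambda>\<tau>. f \<tau> (u \<tau>)))"
    by (intro continuous_intros indefinite_integral_continuous_1 solves_from_integrable[OF assms]) simp
  then show ?thesis
    by (rule continuous_on_eq) (use solves_from_eq[OF assms] in auto)
qed

lemma at_within_atLeast:
  fixes t :: real
  assumes "t < b"
  shows "at t within {s..b} = at t within {s..}"
  by (rule at_within_nhd[of t "{..<b}"]) (use assms in auto)

lemma solves_from_continuous:
  assumes "solves_from f s x u" "s \<le> t"
  shows "continuous (at t within {s..}) u"
proof -
  have "continuous (at t within {s..t + 1}) u"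
    using solves_from_continuous_on[OF assms(1), of "t + 1"] assms(2)
    by (simp add: continuous_on_eq_continuous_within)
  then show ?thesis using at_within_atLeast[of t "t + 1" s] by simp
qed

lemma solves_from_restart:
  assumes "solves_from f s x u" "s \<le> r"
  shows "solves_from f r (u r) u"
  unfolding solves_from_def
proof (intro allI impI)
  fix t assume t: "r \<le> t"
  have "integral {s..r} (\<lambda>\<tau>. f \<tau> (u \<tau>)) + integral {r..t} (\<lambda>\<tau>. f \<tau> (u \<tau>))
      = integral {s..t} (\<lambda>\<tau>. f \<tau> (u \<tau>))"
    by (rule Henstock_Kurzweil_Integration.integral_combine)
       (use assms t solves_from_integrable[OF assms(1)] in auto)
  then have "integral {r..t} (\<lambda>\<tau>. f \<tau> (u \<tau>))
      = integral {s..t} (\<lambda>\<tau>. f \<tau> (u \<tau>)) - integral {s..r} (\<lambda>\<tau>. f \<tau> (u \<tau>))"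
    by (metis add_diff_cancel_left')
  then have "integral {r..t} (\<lambda>\<tau>. f \<tau> (u \<tau>)) = u t - u r"
    using solves_from_eq[OF assms(1), of t] solves_from_eq[OF assms] t assms(2) by simp
  then show "((\<lambda>\<tau>. f \<tau> (u \<tau>)) has_integral u t - u r) {r..t}"
    using solves_from_integrable[OF assms, of t] by (metis integrable_integral)
qed

locale forward_complete_ode =
  fixes f :: "real \<Rightarrow> real ^ 'n \<Rightarrow> real ^ 'n" and t0 :: real
  assumes pc: "\<And>x. piecewise_continuous_from t0 (\<lambda>t. f t x)"
    and lip: "local_lipschitz {t0..} UNIV f"
    and complete: "forward_complete f t0"
begin

text \<open>Although the jump times of \<open>f\<close> may depend on the state, those for a countable dense set of states
  suffice, as \<open>f\<close> is locally Lipschitz in the state uniformly in time.\<close>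
lemma exceptional_times:
  obtains N where "countable N"
    and "\<And>t s w. t \<notin> N \<Longrightarrow> t0 \<le> s \<Longrightarrow> s \<le> t \<Longrightarrow> continuous (at t within {s..}) w
      \<Longrightarrow> continuous (at t within {s..}) (\<lambda>\<tau>. f \<tau> (w \<tau>))"
proof -
  obtain D :: "(real ^ 'n) set" where D: "countable D"
      "\<And>X. open X \<Longrightarrow> X \<noteq> {} \<Longrightarrow> \<exists>d\<in>D. d \<in> X"
    using countable_dense_setE by blast
  define bad where "bad x = {t. t0 \<le> t \<and> \<not> continuous (at t within {t0..}) (\<lambda>\<tau>. f \<tau> x)}" for x
  have "countable (bad x)" for x
  proof -
    have "bad x \<subseteq> (\<Union>k::nat. {t \<in> {t0..real k}. \<not> continuous (at t within {t0..}) (\<lambda>\<tau>. f \<tau> x)})"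
      using real_arch_simple by (auto simp: bad_def)
    moreover have "countable \<dots>"
      using pc[of x] unfolding piecewise_continuous_from_def
      by (intro countable_UN) (auto intro: countable_finite)
    ultimately show ?thesis by (rule countable_subset)
  qed
  then have "countable (\<Union>d\<in>D. bad d)" using D(1) by blast
  moreover have "continuous (at t within {s..}) (\<lambda>\<tau>. f \<tau> (w \<tau>))"
    if t: "t \<notin> (\<Union>d\<in>D. bad d)" "t0 \<le> s" "s \<le> t" and w: "continuous (at t within {s..}) w" for t s w
    unfolding continuous_within tendsto_iff
  proof (intro allI impI)
    fix e :: real assume e: "e > 0"
    have tin: "t \<in> {t0..}" using t by simp
    obtain u L where u: "u > 0" and L: "\<And>\<tau>. \<tau> \<in> cball t u \<inter> {t0..} \<Longrightarrow> L-lipschitz_on (cball (w t) u \<inter> UNIV) (f \<tau>)"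
      using local_lipschitzE[OF lip tin, of "w t"] by auto
    have L0: "0 \<le> L" using L[of t] u tin lipschitz_on_nonneg by auto
    \<comment> \<open>Three errors add up: \<open>e / 2\<close> for replacing
      \<open>w \<tau>\<close> by the dense state \<open>d\<close>, \<open>e / 4\<close> for the
      change of time at the fixed state \<open>d\<close>, and \<open>e / 4\<close> for replacing
      \<open>d\<close> by \<open>w t\<close>.\<close>
    define \<eta> where "\<eta> = min u (e / (4 * (L + 1)))"
    have \<eta>: "\<eta> > 0" "\<eta> \<le> u" using u e L0 by (auto simp: \<eta>_def)
    have L\<eta>: "L * \<eta> \<le> e / 4"
    proof -
      have "L * \<eta> \<le> L * (e / (4 * (L + 1)))" using L0 by (intro mult_left_mono) (auto simp: \<eta>_def)
      also have "\<dots> \<le> e / 4" using L0 e by (simp add: field_simps)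
      finally show ?thesis .
    qed
    obtain d where d: "d \<in> D" "d \<in> ball (w t) \<eta>" using D(2)[of "ball (w t) \<eta>"] \<eta> by auto
    have "continuous (at t within {t0..}) (\<lambda>\<tau>. f \<tau> d)"
      using t d(1) by (auto simp: bad_def)
    then have "continuous (at t within {s..}) (\<lambda>\<tau>. f \<tau> d)"
      by (rule continuous_within_subset) (use t in auto)
    then have "eventually (\<lambda>\<tau>. dist (f \<tau> d) (f t d) < e / 4) (at t within {s..})"
      unfolding continuous_within by (rule tendstoD) (use e in simp)
    moreover have "eventually (\<lambda>\<tau>. dist (w \<tau>) (w t) < \<eta>) (at t within {s..})"
      using w \<eta>(1) unfolding continuous_within tendsto_iff by simp
    moreover have "eventually (\<lambda>\<tau>. \<tau> \<in> cball t u \<inter> {t0..}) (at t within {s..})"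
      unfolding eventually_at using u t by (intro exI[of _ u]) (auto simp: dist_commute)
    ultimately show "eventually (\<lambda>\<tau>. dist (f \<tau> (w \<tau>)) (f t (w t)) < e) (at t within {s..})"
    proof eventually_elim
      fix \<tau> assume a: "dist (f \<tau> d) (f t d) < e / 4" "dist (w \<tau>) (w t) < \<eta>" "\<tau> \<in> cball t u \<inter> {t0..}"
      have d1: "dist (w t) d < \<eta>" using d(2) by simp
      have in1: "w \<tau> \<in> cball (w t) u" "d \<in> cball (w t) u" "w t \<in> cball (w t) u"
        using a(2) d1 \<eta> u by (auto simp: dist_commute)
      have "dist (f \<tau> (w \<tau>)) (f \<tau> d) \<le> L * dist (w \<tau>) d"
        by (rule lipschitz_onD[OF L[OF a(3)]]) (use in1 in auto)
      also have "\<dots> \<le> L * (2 * \<eta>)"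
        using a(2) d1 L0 dist_triangle[of "w \<tau>" d "w t"] by (intro mult_left_mono) auto
      finally have 1: "dist (f \<tau> (w \<tau>)) (f \<tau> d) \<le> e / 2" using L\<eta> by simp
      have "dist (f t d) (f t (w t)) \<le> L * dist d (w t)"
        by (rule lipschitz_onD[OF L[of t]]) (use in1 u tin in auto)
      also have "\<dots> \<le> L * \<eta>"
        using d1 L0 by (intro mult_left_mono) (auto simp: dist_commute)
      finally have 2: "dist (f t d) (f t (w t)) \<le> e / 4" using L\<eta> by simp
      have "dist (f \<tau> (w \<tau>)) (f t (w t)) \<le> dist (f \<tau> (w \<tau>)) (f \<tau> d) + dist (f \<tau> d) (f t d) + dist (f t d) (f t (w t))"
        using dist_triangle[of "f \<tau> (w \<tau>)" "f t (w t)" "f \<tau> d"] dist_triangle[of "f \<tau> d" "f t (w t)" "f t d"] by simp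
      then show "dist (f \<tau> (w \<tau>)) (f t (w t)) < e" using 1 2 a(1) by simp
    qed
  qed
  ultimately show thesis using that by blast
qed

text \<open>The integral equation is differentiated only at times where the integrand is continuous;
  the derivative from the right is all that \<open>norm_right_derivative\<close> uses.\<close>

lemma solution_right_derivative:
  assumes u: "solves_from f s x u" and t: "s \<le> t"
    and cont: "continuous (at t within {s..}) (\<lambda>\<tau>. f \<tau> (u \<tau>))"
  shows "(u has_vector_derivative f t (u t)) (at_right t)"
proof -
  have "((\<lambda>b. integral {s..b} (\<lambda>\<tau>. f \<tau> (u \<tau>))) has_vector_derivative f t (u t)) (at t within ({s..t + 1} - {}))"
    by (rule integral_has_vector_derivative_continuous_at)
       (use t cont at_within_atLeast[of t "t + 1" s] solves_from_integrable[OF u] in auto)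
  then have "((\<lambda>b. x + integral {s..b} (\<lambda>\<tau>. f \<tau> (u \<tau>))) has_vector_derivative f t (u t)) (at t within {t..t + 1})"
    using t by (auto intro!: derivative_eq_intros elim: has_vector_derivative_within_subset)
  then have "(u has_vector_derivative f t (u t)) (at t within {t..t + 1})"
    by (rule has_vector_derivative_transform[rotated 2]) (use t solves_from_eq[OF u] in auto)
  then show ?thesis using at_within_Icc_at_right[of t "t + 1"] by simp
qed

text \<open>Bisection of \<open>{s..T}\<close> merges the local radii and Lipschitz constants into
  one of each: adjacent intervals combine by minimum and maximum.\<close>

lemma lipschitz_tube:
  assumes u: "solves_from f s x u" and s: "t0 \<le> s" and T: "s \<le> T"
  shows "\<exists>r>0. \<exists>L\<ge>0. \<forall>t\<in>{s..T}. L-lipschitz_on (cball (u t) r) (f t)"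
proof -
  define P where "P a b \<longleftrightarrow> (\<exists>r>0. \<exists>L\<ge>0. \<forall>t\<in>{s..T} \<inter> {a..b}. L-lipschitz_on (cball (u t) r) (f t))" for a b
  have "P s T" using T
  proof (induction rule: Bolzano)
    case (trans a b c)
    obtain r1 L1 where 1: "r1 > 0" "L1 \<ge> 0" "\<And>t. t \<in> {s..T} \<inter> {a..b} \<Longrightarrow> L1-lipschitz_on (cball (u t) r1) (f t)"
      using trans(1) unfolding P_def by blast
    obtain r2 L2 where 2: "r2 > 0" "L2 \<ge> 0" "\<And>t. t \<in> {s..T} \<inter> {b..c} \<Longrightarrow> L2-lipschitz_on (cball (u t) r2) (f t)"
      using trans(2) unfolding P_def by blast
    have "(max L1 L2)-lipschitz_on (cball (u t) (min r1 r2)) (f t)" if "t \<in> {s..T} \<inter> {a..c}" for t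
    proof (cases "t \<le> b")
      case True
      then have "L1-lipschitz_on (cball (u t) r1) (f t)" using 1 that by auto
      then show ?thesis by (rule lipschitz_on_mono) auto
    next
      case False
      then have "L2-lipschitz_on (cball (u t) r2) (f t)" using 2 that by auto
      then show ?thesis by (rule lipschitz_on_mono) auto
    qed
    then show ?case unfolding P_def using 1 2
      by (intro exI[of _ "min r1 r2"] conjI exI[of _ "max L1 L2"]) auto
  next
    case (local \<tau>)
    have \<tau>: "\<tau> \<in> {t0..}" using local s by simp
    obtain \<rho> L where \<rho>: "\<rho> > 0" and L: "\<And>t. t \<in> cball \<tau> \<rho> \<inter> {t0..} \<Longrightarrow> L-lipschitz_on (cball (u \<tau>) \<rho> \<inter> UNIV) (f t)"
      using local_lipschitzE[OF lip \<tau>, of "u \<tau>"] by auto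
    have L0: "0 \<le> L" using L[of \<tau>] \<rho> \<tau> lipschitz_on_nonneg by auto
    have "continuous_on {s..T} u" by (rule solves_from_continuous_on[OF u])
    \<comment> \<open>With half the radius, the ball about \<open>u t\<close> still lies in the ball
      of radius \<open>\<rho>\<close> about \<open>u \<tau>\<close>.\<close>
    then obtain d where d: "d > 0" "\<And>t. t \<in> {s..T} \<Longrightarrow> dist t \<tau> < d \<Longrightarrow> dist (u t) (u \<tau>) < \<rho> / 2"
      using local \<rho> unfolding continuous_on_iff by (metis atLeastAtMost_iff half_gt_zero)
    show ?case
    proof (intro exI[of _ "min d \<rho>"] conjI allI impI)
      show "min d \<rho> > 0" using d \<rho> by simp
      fix a b assume ab: "a \<le> \<tau> \<and> \<tau> \<le> b \<and> b - a < min d \<rho>"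
      have "L-lipschitz_on (cball (u t) (\<rho> / 2)) (f t)" if t: "t \<in> {s..T} \<inter> {a..b}" for t
      proof (rule lipschitz_on_subset)
        show "L-lipschitz_on (cball (u \<tau>) \<rho> \<inter> UNIV) (f t)"
          by (rule L) (use ab t s in \<open>auto simp: dist_real_def\<close>)
        have "dist (u t) (u \<tau>) < \<rho> / 2" using d(2)[of t] t ab by (auto simp: dist_real_def)
        then show "cball (u t) (\<rho> / 2) \<subseteq> cball (u \<tau>) \<rho> \<inter> UNIV"
        proof (intro subsetI IntI UNIV_I)
          fix z assume "z \<in> cball (u t) (\<rho> / 2)"
          then show "z \<in> cball (u \<tau>) \<rho>"
            using \<open>dist (u t) (u \<tau>) < \<rho> / 2\<close> dist_triangle[of "u \<tau>" z "u t"] by (simp add: dist_commute)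
        qed
      qed
      then show "P a b" unfolding P_def using \<rho> L0 by (intro exI[of _ "\<rho> / 2"] conjI exI[of _ L]) auto
    qed
  qed
  then show ?thesis by (simp add: P_def)
qed

text \<open>Gronwall for the difference of two solutions. \<open>S\<close> is general because
  \<open>sol_lipschitz_near\<close> takes a tube around a third solution.\<close>

lemma solutions_in_tube:
  assumes v: "solves_from f s y v" and w: "solves_from f s z w"
    and tube: "\<And>t. t \<in> {s..b} \<Longrightarrow> L-lipschitz_on (S t) (f t) \<and> v t \<in> S t \<and> w t \<in> S t"
    and t: "t \<in> {s..b}"
  shows "norm (v t - w t) \<le> norm (y - z) * exp (L * (t - s))"
proof (rule gronwall_integral[of s b "\<lambda>t. norm (v t - w t)"])
  have "continuous_on {s..b} v" "continuous_on {s..b} w"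
    using v w by (auto intro: solves_from_continuous_on)
  then show cont: "continuous_on {s..b} (\<lambda>t. norm (v t - w t))" by (intro continuous_intros)
  show L: "0 \<le> L" using tube[OF t] lipschitz_on_nonneg by blast
  show "t \<in> {s..b}" by (rule t)
  fix t assume t: "t \<in> {s..b}"
  let ?g = "\<lambda>\<tau>. f \<tau> (v \<tau>) - f \<tau> (w \<tau>)"
  have vi: "(\<lambda>\<tau>. f \<tau> (v \<tau>)) integrable_on {s..t}" and wi: "(\<lambda>\<tau>. f \<tau> (w \<tau>)) integrable_on {s..t}"
    using solves_from_integrable[OF v] solves_from_integrable[OF w] by auto
  have eq: "v t - w t = (y - z) + integral {s..t} ?g"
    using solves_from_eq[OF v, of t] solves_from_eq[OF w, of t] t vi wi by (simp add: integral_diff)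
  have "continuous_on {s..t} (\<lambda>\<tau>. norm (v \<tau> - w \<tau>))"
    using cont by (rule continuous_on_subset) (use t in auto)
  then have ni: "(\<lambda>\<tau>. L * norm (v \<tau> - w \<tau>)) integrable_on {s..t}"
    by (intro integrable_continuous_real continuous_on_mult_left)
  have "norm (integral {s..t} ?g) \<le> integral {s..t} (\<lambda>\<tau>. L * norm (v \<tau> - w \<tau>))"
  proof (rule Henstock_Kurzweil_Integration.integral_norm_bound_integral[OF _ ni])
    show "?g integrable_on {s..t}" using vi wi by (rule integrable_diff)
    fix \<tau> assume "\<tau> \<in> {s..t}"
    then have "\<tau> \<in> {s..b}" using t by simp
    from tube[OF this] show "norm (?g \<tau>) \<le> L * norm (v \<tau> - w \<tau>)"
      using lipschitz_onD[of L "S \<tau>" "f \<tau>" "v \<tau>" "w \<tau>"] by (simp add: dist_norm)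
  qed
  then show "norm (v t - w t) \<le> norm (y - z) + L * integral {s..t} (\<lambda>\<tau>. norm (v \<tau> - w \<tau>))"
    unfolding eq using norm_triangle_ineq[of "y - z" "integral {s..t} ?g"] by simp
qed

text \<open>First-exit argument: up to the first time \<open>m\<close> at which the distance reaches
  \<open>r\<close>, both solutions lie in the tube, so Gronwall keeps the distance at
  \<open>m\<close> below \<open>r\<close>, a contradiction.\<close>

lemma solution_stays_in_tube:
  assumes u: "solves_from f s x u" and v: "solves_from f s y v" and r: "0 < r"
    and tube: "\<And>t. t \<in> {s..T} \<Longrightarrow> L-lipschitz_on (cball (u t) r) (f t)"
    and close: "norm (y - x) * exp (L * (T - s)) < r" and t: "t \<in> {s..T}"
  shows "v t \<in> cball (u t) r"
proof (rule ccontr)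
  assume nt: "v t \<notin> cball (u t) r"
  define Z where "Z = {t \<in> {s..T}. r \<le> norm (v t - u t)}"
  have L: "0 \<le> L" using tube[OF t] lipschitz_on_nonneg by blast
  have cont: "continuous_on {s..T} (\<lambda>t. norm (v t - u t))"
    by (intro continuous_intros solves_from_continuous_on[OF u] solves_from_continuous_on[OF v])
  have "closed Z"
    unfolding Z_def using continuous_closed_preimage[OF cont, of "{r..}"]
    by (simp add: vimage_def Int_def conj_commute)
  moreover have "bounded Z" unfolding Z_def by (rule bounded_subset[OF bounded_closed_interval[of s T]]) auto
  ultimately have "compact Z" by (simp add: compact_eq_bounded_closed)
  moreover have "Z \<noteq> {}" using nt t by (auto simp: Z_def dist_norm norm_minus_commute)
  ultimately obtain m where m: "m \<in> Z" "\<And>t. t \<in> Z \<Longrightarrow> m \<le> t"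
    using compact_attains_inf by metis
  have before: "norm (v \<tau> - u \<tau>) < r" if "\<tau> \<in> {s..<m}" for \<tau>
    using m that by (fastforce simp: Z_def)
  have "s < m"
  proof -
    have "norm (v s - u s) < r"
    proof -
      have "norm (y - x) * 1 \<le> norm (y - x) * exp (L * (T - s))"
        using L t by (intro mult_left_mono) auto
      then show ?thesis using close solves_from_init[OF u] solves_from_init[OF v] by simp
    qed
    then have "m \<noteq> s" using m(1) by (auto simp: Z_def)
    then show ?thesis using m(1) by (simp add: Z_def)
  qed
  \<comment> \<open>Continuity forbids jumping over \<open>r\<close>: a larger value at
    \<open>m\<close> would force the value \<open>r\<close> before \<open>m\<close>.\<close>
  have at_m: "norm (v m - u m) \<le> r"
  proof (rule ccontr)
    assume "\<not> norm (v m - u m) \<le> r"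
    moreover have "continuous_on {s..m} (\<lambda>t. norm (v t - u t))"
      using cont by (rule continuous_on_subset) (use m in \<open>auto simp: Z_def\<close>)
    ultimately obtain \<tau> where "s \<le> \<tau>" "\<tau> \<le> m" "norm (v \<tau> - u \<tau>) = r"
      using IVT'[of "\<lambda>t. norm (v t - u t)" s r m] before[of s] \<open>s < m\<close> by auto
    then show False using before[of \<tau>] \<open>\<not> norm (v m - u m) \<le> r\<close> by (cases "\<tau> = m") auto
  qed
  have "norm (v m - u m) \<le> norm (y - x) * exp (L * (m - s))"
  proof (rule solutions_in_tube[OF v u, of m L "\<lambda>t. cball (u t) r"])
    fix \<tau> assume \<tau>: "\<tau> \<in> {s..m}"
    then have "norm (v \<tau> - u \<tau>) \<le> r" using before[of \<tau>] at_m by (cases "\<tau> = m") auto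
    then show "L-lipschitz_on (cball (u \<tau>) r) (f \<tau>) \<and> v \<tau> \<in> cball (u \<tau>) r \<and> u \<tau> \<in> cball (u \<tau>) r"
      using tube[of \<tau>] \<tau> m r by (auto simp: Z_def dist_norm norm_minus_commute)
  qed (use \<open>s < m\<close> in simp)
  also have "\<dots> \<le> norm (y - x) * exp (L * (T - s))"
    using m L by (intro mult_left_mono) (auto simp: Z_def mult_left_mono)
  finally show False using close m by (simp add: Z_def)
qed

section \<open>Uniqueness and the solution map\<close>

lemma solution_unique:
  assumes u: "solves_from f s x u" and v: "solves_from f s x v" and s: "t0 \<le> s" and t: "s \<le> t"
  shows "v t = u t"
proof -
  obtain r L where rL: "r > 0" "\<And>\<tau>. \<tau> \<in> {s..t} \<Longrightarrow> L-lipschitz_on (cball (u \<tau>) r) (f \<tau>)"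
    using lipschitz_tube[OF u s t] by blast
  have "norm (v t - u t) \<le> norm (x - x) * exp (L * (t - s))"
  proof (rule solutions_in_tube[OF v u, of t L "\<lambda>t. cball (u t) r"])
    fix \<tau> assume \<tau>: "\<tau> \<in> {s..t}"
    then show "L-lipschitz_on (cball (u \<tau>) r) (f \<tau>) \<and> v \<tau> \<in> cball (u \<tau>) r \<and> u \<tau> \<in> cball (u \<tau>) r"
      using rL solution_stays_in_tube[OF u v rL(1) rL(2) _ \<tau>] by auto
  qed (use t in simp)
  then show ?thesis by simp
qed

lemma sol_eq:
  assumes u: "solves_from f s x u" and s: "t0 \<le> s" and t: "s \<le> t"
  shows "sol f t s x = u t"
  unfolding sol_def
proof (rule the_equality)
  show "\<exists>v. solves_from f s x v \<and> v t = u t" using u by blast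
  show "y = u t" if "\<exists>v. solves_from f s x v \<and> v t = y" for y
    using that solution_unique[OF u _ s t] by blast
qed

lemma solves_from_sol:
  assumes s: "t0 \<le> s"
  shows "solves_from f s x (\<lambda>t. sol f t s x)"
proof -
  obtain u where u: "solves_from f s x u"
    using complete s unfolding forward_complete_def by blast
  show ?thesis
    unfolding solves_from_def
  proof (intro allI impI)
    fix t assume t: "s \<le> t"
    have "((\<lambda>\<tau>. f \<tau> (u \<tau>)) has_integral u t - x) {s..t}"
      using u t unfolding solves_from_def by blast
    then show "((\<lambda>\<tau>. f \<tau> (sol f \<tau> s x)) has_integral sol f t s x - x) {s..t}"
      unfolding sol_eq[OF u s t]
      by (rule has_integral_eq[rotated]) (simp add: sol_eq[OF u s])
  qed
qed

lemma sol_semigroup: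
  assumes "t0 \<le> s" "s \<le> r" "r \<le> t"
  shows "sol f t r (sol f r s x) = sol f t s x"
  using sol_eq[OF solves_from_restart[OF solves_from_sol[OF assms(1)] assms(2)], of t x] assms by simp

text \<open>Every point has a ball on which the flow up to \<open>T\<close> is Lipschitz, and
  compactness leaves finitely many of these. \<open>y\<close> ranges over the whole space, so that
  the lemma says something for a singleton \<open>C\<close> too.\<close>

lemma sol_lipschitz_near:
  assumes C: "compact C" and s: "t0 \<le> s" "s \<le> T"
  shows "\<exists>\<delta>>0. \<exists>M\<ge>0. \<forall>x\<in>C. \<forall>y. norm (y - x) < \<delta> \<longrightarrow>
    (\<forall>t\<in>{s..T}. norm (sol f t s y - sol f t s x) \<le> M * norm (y - x))"
proof -
  have "\<exists>d M. d > 0 \<and> M \<ge> 0 \<and> (\<forall>y\<in>ball x d. \<forall>z\<in>ball x d. \<forall>t\<in>{s..T}.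
      norm (sol f t s y - sol f t s z) \<le> M * norm (y - z))" for x
  proof -
    note sv = solves_from_sol[OF s(1)]
    obtain r L where rL: "r > 0" "L \<ge> 0" "\<And>\<tau>. \<tau> \<in> {s..T} \<Longrightarrow> L-lipschitz_on (cball (sol f \<tau> s x) r) (f \<tau>)"
      using lipschitz_tube[OF sv s, of x] by blast
    \<comment> \<open>This exponential shrinking is what \<open>solution_stays_in_tube\<close>
      demands of the initial distance.\<close>
    define d where "d = r * exp (- L * (T - s))"
    have stay: "sol f t s y \<in> cball (sol f t s x) r" if "y \<in> ball x d" "t \<in> {s..T}" for y t
    proof (rule solution_stays_in_tube[OF sv sv rL(1) rL(3) _ that(2)])
      have "norm (y - x) * exp (L * (T - s)) < d * exp (L * (T - s))"
        using that(1) by (simp add: dist_norm norm_minus_commute)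
      also have "\<dots> = r" by (simp add: d_def mult.assoc exp_add[symmetric])
      finally show "norm (y - x) * exp (L * (T - s)) < r" .
    qed
    have "norm (sol f t s y - sol f t s z) \<le> exp (L * (T - s)) * norm (y - z)"
      if "y \<in> ball x d" "z \<in> ball x d" and t: "t \<in> {s..T}" for y z t
    proof -
      have "norm (sol f t s y - sol f t s z) \<le> norm (y - z) * exp (L * (t - s))"
        by (rule solutions_in_tube[OF sv sv, of T L "\<lambda>t. cball (sol f t s x) r"])
           (use rL stay that in auto)
      also have "\<dots> \<le> norm (y - z) * exp (L * (T - s))"
        using t rL by (intro mult_left_mono) (auto intro: mult_left_mono)
      finally show ?thesis by (simp add: mult.commute)
    qed
    moreover have "d > 0" using rL by (simp add: d_def)
    ultimately show ?thesis by (intro exI[of _ d] exI[of _ "exp (L * (T - s))"]) auto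
  qed
  then obtain d M where dM: "\<And>x. d x > 0" "\<And>x. M x \<ge> 0"
      "\<And>x y z t. y \<in> ball x (d x) \<Longrightarrow> z \<in> ball x (d x) \<Longrightarrow> t \<in> {s..T} \<Longrightarrow>
        norm (sol f t s y - sol f t s z) \<le> M x * norm (y - z)"
    by metis
  \<comment> \<open>The cover uses half the radius, so that a point \<open>y\<close> near a covered
    \<open>x\<close> is still in the full ball with the same centre.\<close>
  obtain F where F: "F \<subseteq> C" "finite F" "C \<subseteq> (\<Union>x\<in>F. ball x (d x / 2))"
  proof (rule compactE_image[OF C, of C "\<lambda>x. ball x (d x / 2)"])
    show "C \<subseteq> (\<Union>x\<in>C. ball x (d x / 2))" using dM(1) by (meson UN_I centre_in_ball half_gt_zero subsetI)
  qed auto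
  \<comment> \<open>The inserted 1 here and 0 in \<open>Mm\<close> take care of an empty
    \<open>F\<close>.\<close>
  define \<delta> where "\<delta> = Min (insert 1 ((\<lambda>x. d x / 2) ` F))"
  define Mm where "Mm = Max (insert 0 (M ` F))"
  have "norm (sol f t s y - sol f t s x) \<le> Mm * norm (y - x)"
    if a: "x \<in> C" "norm (y - x) < \<delta>" "t \<in> {s..T}" for x y t
  proof -
    obtain p where p: "p \<in> F" "x \<in> ball p (d p / 2)" using F a by blast
    have "\<delta> \<le> d p / 2" unfolding \<delta>_def by (rule Min_le) (use p F in auto)
    then have "y \<in> ball p (d p)"
      using p a(2) dist_triangle[of p y x] by (simp add: dist_norm norm_minus_commute)
    moreover have "x \<in> ball p (d p)" using p dM(1)[of p] by simp
    ultimately have "norm (sol f t s y - sol f t s x) \<le> M p * norm (y - x)" using dM(3) a by blast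
    also have "\<dots> \<le> Mm * norm (y - x)"
      using p F by (intro mult_right_mono) (auto simp: Mm_def)
    finally show ?thesis .
  qed
  moreover have "\<delta> > 0" using F(2) dM(1) by (simp add: \<delta>_def)
  moreover have "Mm \<ge> 0" using F(2) by (simp add: Mm_def)
  ultimately show ?thesis by blast
qed

lemma continuous_on_sol:
  assumes "t0 \<le> s" "s \<le> t"
  shows "continuous_on S (\<lambda>x. sol f t s x)"
proof -
  have "continuous (at x) (\<lambda>x. sol f t s x)" for x
  proof -
    obtain \<delta> M where d: "\<delta> > 0" "M \<ge> 0"
      "\<And>y. norm (y - x) < \<delta> \<Longrightarrow> norm (sol f t s y - sol f t s x) \<le> M * norm (y - x)"
      using sol_lipschitz_near[OF compact_sing[of x] assms] assms(2) by auto
    show ?thesis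
      unfolding continuous_at_eps_delta
    proof (intro allI impI)
      fix e :: real assume e: "e > 0"
      show "\<exists>d>0. \<forall>x'. dist x' x < d \<longrightarrow> dist (sol f t s x') (sol f t s x) < e"
      proof (intro exI[of _ "min \<delta> (e / (M + 1))"] conjI allI impI)
        show "0 < min \<delta> (e / (M + 1))" using d e by simp
        fix y assume y: "dist y x < min \<delta> (e / (M + 1))"
        have "norm (sol f t s y - sol f t s x) \<le> M * norm (y - x)" using d(3) y by (simp add: dist_norm)
        also have "\<dots> \<le> (M + 1) * norm (y - x)" by (simp add: algebra_simps)
        also have "\<dots> < e" using y d(2) by (simp add: dist_norm field_simps)
        finally show "dist (sol f t s y) (sol f t s x) < e" by (simp add: dist_norm)
      qed
    qed
  qed
  then show ?thesis by (simp add: continuous_at_imp_continuous_on)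
qed

end

section \<open>Expansion of the flow along trajectories\<close>

lemma lipschitz_on_mult_bounded:
  fixes g h :: "real \<Rightarrow> real"
  assumes g: "Lg-lipschitz_on S g" and h: "Lh-lipschitz_on S h"
    and B: "\<And>x. x \<in> S \<Longrightarrow> \<bar>g x\<bar> \<le> Bg" "\<And>x. x \<in> S \<Longrightarrow> \<bar>h x\<bar> \<le> Bh" "0 \<le> Bg" "0 \<le> Bh"
  shows "(Lg * Bh + Bg * Lh)-lipschitz_on S (\<lambda>x. g x * h x)"
proof (rule lipschitz_onI)
  have L: "0 \<le> Lg" "0 \<le> Lh" using g h lipschitz_on_nonneg by auto
  show "0 \<le> Lg * Bh + Bg * Lh" using L B by simp
  fix x y assume xy: "x \<in> S" "y \<in> S"
  have "g x * h x - g y * h y = (g x - g y) * h x + g y * (h x - h y)" by (simp add: algebra_simps)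
  then have "dist (g x * h x) (g y * h y) \<le> \<bar>g x - g y\<bar> * \<bar>h x\<bar> + \<bar>g y\<bar> * \<bar>h x - h y\<bar>"
    by (metis abs_mult abs_triangle_ineq dist_real_def)
  also have "\<dots> \<le> (Lg * dist x y) * Bh + Bg * (Lh * dist x y)"
    using lipschitz_onD[OF g xy] lipschitz_onD[OF h xy] B xy L
    by (intro add_mono mult_mono) (auto simp: dist_real_def)
  finally show "dist (g x * h x) (g y * h y) \<le> (Lg * Bh + Bg * Lh) * dist x y"
    by (simp add: algebra_simps)
qed

lemma exp_lipschitz_on_interval:
  fixes c :: real
  shows "\<exists>L E. L-lipschitz_on {a..b} (\<lambda>t. exp (- c * t)) \<and> E > 0 \<and> (\<forall>t\<in>{a..b}. exp (- c * t) \<le> E)"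
proof -
  define E where "E = exp (\<bar>c\<bar> * (\<bar>a\<bar> + \<bar>b\<bar>))"
  have E: "exp (- c * t) \<le> E" if "t \<in> {a..b}" for t
  proof -
    have "- c * t \<le> \<bar>c\<bar> * \<bar>t\<bar>" by (metis abs_ge_self abs_minus_cancel abs_mult)
    also have "\<dots> \<le> \<bar>c\<bar> * (\<bar>a\<bar> + \<bar>b\<bar>)" using that by (intro mult_left_mono) auto
    finally show ?thesis by (simp add: E_def)
  qed
  have "(\<bar>c\<bar> * E)-lipschitz_on {a..b} (\<lambda>t. exp (- c * t))"
  proof (rule lipschitz_onI)
    fix x y assume xy: "x \<in> {a..b}" "y \<in> {a..b}"
    have "norm (exp (- c * x) - exp (- c * y)) \<le> (\<bar>c\<bar> * E) * norm (x - y)"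
    proof (rule field_differentiable_bound[of "{a..b}" _ "\<lambda>t. - c * exp (- c * t)"])
      fix t assume t: "t \<in> {a..b}"
      show "((\<lambda>t. exp (- c * t)) has_field_derivative - c * exp (- c * t)) (at t within {a..b})"
        by (auto intro!: derivative_eq_intros)
      show "norm (- c * exp (- c * t)) \<le> \<bar>c\<bar> * E"
        using E[OF t] by (simp add: abs_mult mult_left_mono)
    qed (use xy in auto)
    then show "dist (exp (- c * x)) (exp (- c * y)) \<le> (\<bar>c\<bar> * E) * dist x y"
      by (simp add: dist_norm)
  qed (simp add: E_def)
  moreover have "E > 0" by (simp add: E_def)
  ultimately show ?thesis using E by blast
qed

context forward_complete_ode
begin

text \<open>The fundamental theorem for the weighted distance of two solutions. The weight turns
  growth at rate at most \<open>c\<close> into a sign of the integrand. Bounds reach to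
  \<open>b + 1\<close> because \<open>right_derivative_has_integral\<close> looks beyond
  \<open>b\<close>.\<close>

lemma norm_difference_integral:
  assumes G: "norm_on UNIV G" and u: "solves_from f a x u" and v: "solves_from f a y v" and ab: "t0 \<le> a" "a \<le> b"
    and N: "countable N" "\<And>t w. t \<notin> N \<Longrightarrow> a \<le> t \<Longrightarrow> continuous (at t within {a..}) w
      \<Longrightarrow> continuous (at t within {a..}) (\<lambda>\<tau>. f \<tau> (w \<tau>))"
    and B: "\<And>t. t \<in> {a..b + 1} \<Longrightarrow> norm (f t (v t) - f t (u t)) \<le> B"
    and B': "\<And>t. t \<in> {a..b + 1} \<Longrightarrow> norm (v t - u t) \<le> B'"
  shows "((\<lambda>t. exp (- c * t) * (norm_dd G (v t - u t) (f t (v t) - f t (u t)) - c * G (v t - u t)))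
    has_integral (exp (- c * b) * G (v b - u b) - exp (- c * a) * G (y - x))) {a..b}"
proof -
  define z where "z t = v t - u t" for t
  define g where "g t = f t (v t) - f t (u t)" for t
  obtain CG where CG: "CG > 0" "\<And>v. G v \<le> CG * norm v" using norm_on_upper[OF G subspace_UNIV] by auto
  have gi: "g integrable_on {s..t}" if "a \<le> s" for s t
    unfolding g_def using solves_from_integrable[OF u that] solves_from_integrable[OF v that] by (rule integrable_diff[rotated])
  have zeq: "z t - z s = integral {s..t} g" if "a \<le> s" "s \<le> t" for s t
  proof -
    have "v t = v s + integral {s..t} (\<lambda>\<tau>. f \<tau> (v \<tau>))" "u t = u s + integral {s..t} (\<lambda>\<tau>. f \<tau> (u \<tau>))"
      using solves_from_eq[OF solves_from_restart[OF v that(1)] that(2)]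
        solves_from_eq[OF solves_from_restart[OF u that(1)] that(2)] .
    then show ?thesis
      unfolding z_def g_def using solves_from_integrable[OF u that(1)] solves_from_integrable[OF v that(1)]
      by (simp add: integral_diff)
  qed
  have B0: "0 \<le> B" "0 \<le> B'" using B[of a] B'[of a] ab by (auto intro: order_trans[OF norm_ge_zero])
  have zle: "norm (z t - z s) \<le> B * (t - s)" if "a \<le> s" "s \<le> t" "t \<le> b + 1" for s t
  proof -
    have "norm (integral {s..t} g) \<le> integral {s..t} (\<lambda>_. B)"
      by (rule Henstock_Kurzweil_Integration.integral_norm_bound_integral[OF gi[OF that(1)] integrable_const_ivl])
         (use B that in \<open>auto simp: g_def\<close>)
    then show ?thesis using zeq[OF that(1,2)] that by (simp add: mult.commute)
  qed
  have zlip: "dist (G (z s)) (G (z t)) \<le> (CG * B) * dist s t" if "s \<in> {a..b + 1}" "t \<in> {a..b + 1}" for s t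
  proof -
    have "norm (z s - z t) \<le> B * dist s t"
      using zle[of s t] zle[of t s] that by (cases "s \<le> t") (auto simp: dist_real_def norm_minus_commute)
    then have "CG * norm (z s - z t) \<le> CG * (B * dist s t)" using CG(1) by simp
    then show ?thesis
      using norm_on_triangle_sub[OF G subspace_UNIV, of "z s" "z t"] CG(2)[of "z s - z t"] by (simp add: dist_real_def)
  qed
  then have Gzlip: "(CG * B)-lipschitz_on {a..b + 1} (\<lambda>t. G (z t))"
    using CG(1) B0 by (intro lipschitz_onI) auto
  obtain Le E where E: "Le-lipschitz_on {a..b + 1} (\<lambda>t. exp (- c * t))" "E > 0" "\<And>t. t \<in> {a..b + 1} \<Longrightarrow> exp (- c * t) \<le> E"
    using exp_lipschitz_on_interval by blast
  have lip: "(Le * (CG * B') + E * (CG * B))-lipschitz_on {a..b + 1} (\<lambda>t. exp (- c * t) * G (z t))"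
  proof (rule lipschitz_on_mult_bounded[OF E(1) Gzlip])
    fix t assume t: "t \<in> {a..b + 1}"
    show "\<bar>exp (- c * t)\<bar> \<le> E" using E(3)[OF t] by simp
    have "G (z t) \<le> CG * norm (z t)" by (rule CG(2))
    also have "\<dots> \<le> CG * B'" using B'[OF t] CG(1) by (simp add: z_def)
    finally show "\<bar>G (z t)\<bar> \<le> CG * B'" using norm_onD(1)[OF G] by simp
  qed (use E CG B0 in auto)
  have der: "((\<lambda>t. exp (- c * t) * G (z t)) has_real_derivative
      exp (- c * t) * (norm_dd G (z t) (g t) - c * G (z t))) (at_right t)"
    if t: "t \<in> {a..b} - N" for t
  proof -
    have ta: "t \<notin> N" "a \<le> t" using t by auto
    have "(u has_vector_derivative f t (u t)) (at_right t)" "(v has_vector_derivative f t (v t)) (at_right t)"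
      using solution_right_derivative[OF u ta(2) N(2)[OF ta solves_from_continuous[OF u ta(2)]]]
        solution_right_derivative[OF v ta(2) N(2)[OF ta solves_from_continuous[OF v ta(2)]]] .
    then have "(z has_vector_derivative g t) (at_right t)"
      unfolding z_def g_def by (intro has_vector_derivative_diff)
    from norm_right_derivative[OF G this]
    have "((\<lambda>t. G (z t)) has_real_derivative norm_dd G (z t) (g t)) (at_right t)" .
    then show ?thesis
      by (auto intro!: derivative_eq_intros simp: algebra_simps)
  qed
  have "((\<lambda>t. exp (- c * t) * (norm_dd G (z t) (g t) - c * G (z t))) has_integral
      (exp (- c * b) * G (z b) - exp (- c * a) * G (z a))) {a..b}"
    by (rule right_derivative_has_integral[OF ab(2) lip N(1) der])
  then show ?thesis
    using solves_from_init[OF u] solves_from_init[OF v] by (simp add: z_def g_def)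
qed

text \<open>The Jacobian need not be continuous in time, so the first-order error is controlled by dominated
  convergence along a sequence of initial states tending to \<open>x\<close>, rather than uniformly in time.\<close>
lemma expansion_at_point:
  assumes G: "norm_on UNIV G" and a: "t0 \<le> a" "a \<le> b"
    and diff: "\<And>t. t \<in> {a..b} \<Longrightarrow> f t differentiable (at (sol f t a x))"
    and dd: "\<And>t z. t \<in> {a..b} \<Longrightarrow> norm_dd G z (jacobian (f t) (at (sol f t a x)) *v z) \<le> c * G z"
  shows "\<exists>\<delta>>0. \<forall>y. norm (y - x) < \<delta> \<longrightarrow>
    G (sol f b a y - sol f b a x) \<le> 2 * exp (c * (b - a)) * G (y - x)"
proof (rule ccontr)
  assume neg: "\<not> ?thesis"
  have ab1: "a \<le> b + 1" using a by simp
  define X where "X t = sol f t a x" for t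
  obtain \<delta>1 M where M: "\<delta>1 > 0" "M \<ge> 0"
    "\<And>y t. norm (y - x) < \<delta>1 \<Longrightarrow> t \<in> {a..b + 1} \<Longrightarrow> norm (sol f t a y - X t) \<le> M * norm (y - x)"
    using sol_lipschitz_near[OF compact_sing[of x] a(1) ab1] unfolding X_def by auto
  obtain r L where rL: "r > 0" "L \<ge> 0" "\<And>t. t \<in> {a..b + 1} \<Longrightarrow> L-lipschitz_on (cball (X t) r) (f t)"
    using lipschitz_tube[OF solves_from_sol[OF a(1)] a(1) ab1, of x] unfolding X_def by blast
  obtain CG where CG: "CG > 0" "\<And>v. G v \<le> CG * norm v" using norm_on_upper[OF G subspace_UNIV] by auto
  obtain cg where cg: "cg > 0" "\<And>v. cg * norm v \<le> G v" using norm_on_lower[OF G subspace_UNIV] by auto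
  \<comment> \<open>\<open>r / (M + 1)\<close> keeps the perturbed solutions in the tube of radius
    \<open>r\<close> up to time \<open>b + 1\<close>.\<close>
  define \<delta>0 where "\<delta>0 = min \<delta>1 (r / (M + 1))"
  have \<delta>0: "\<delta>0 > 0" using M rL by (simp add: \<delta>0_def)
  \<comment> \<open>If the claim fails, violating initial states exist arbitrarily near
    \<open>x\<close>; the sequence \<open>Y\<close> collects them.\<close>
  have "\<exists>y. norm (y - x) < min \<delta>0 (1 / real (Suc k)) \<and>
      \<not> G (sol f b a y - sol f b a x) \<le> 2 * exp (c * (b - a)) * G (y - x)" for k
    using neg \<delta>0 by (metis min_less_iff_conj of_nat_0_less_iff zero_less_Suc zero_less_divide_1_iff)
  then obtain Y where Y: "\<And>k. norm (Y k - x) < min \<delta>0 (1 / real (Suc k))"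
      "\<And>k. 2 * exp (c * (b - a)) * G (Y k - x) < G (sol f b a (Y k) - sol f b a x)"
    by (metis not_le)
  define V where "V k t = sol f t a (Y k)" for k t
  define z where "z k t = V k t - X t" for k t
  define g where "g k t = f t (V k t) - f t (X t)" for k t
  define \<eta> where "\<eta> k = G (Y k - x)" for k
  have sX: "solves_from f a x X" unfolding X_def by (rule solves_from_sol[OF a(1)])
  have sV: "solves_from f a (Y k) (V k)" for k unfolding V_def by (rule solves_from_sol[OF a(1)])
  have \<eta>: "\<eta> k > 0" for k
  proof -
    have "Y k \<noteq> x" using Y(2)[of k] norm_onD(2)[OF G, of 0] by auto
    then show ?thesis using norm_onD(1,2)[OF G, of "Y k - x"] by (simp add: \<eta>_def)
  qed
  have zM: "norm (z k t) \<le> M * norm (Y k - x)" if "t \<in> {a..b + 1}" for k t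
    using M(3)[of "Y k" t] Y(1)[of k] that by (simp add: z_def V_def \<delta>0_def)
  have zr: "norm (z k t) \<le> r" if "t \<in> {a..b + 1}" for k t
  proof -
    have "norm (z k t) \<le> M * norm (Y k - x)" by (rule zM[OF that])
    also have "\<dots> \<le> (M + 1) * (r / (M + 1))"
      using Y(1)[of k] M(2) by (intro mult_mono) (auto simp: \<delta>0_def)
    also have "\<dots> = r" using M(2) by simp
    finally show ?thesis .
  qed
  have z\<eta>: "norm (z k t) \<le> (M / cg) * \<eta> k" if "t \<in> {a..b + 1}" for k t
  proof -
    have "norm (z k t) \<le> M * norm (Y k - x)" by (rule zM[OF that])
    also have "\<dots> \<le> M * (\<eta> k / cg)"
      using cg(1) cg(2)[of "Y k - x"] M(2) by (intro mult_left_mono) (auto simp: \<eta>_def field_simps)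
    finally show ?thesis by simp
  qed
  have gL: "norm (g k t) \<le> L * norm (z k t)" if t: "t \<in> {a..b + 1}" for k t
    using lipschitz_onD[OF rL(3)[OF t], of "V k t" "X t"] zr[OF t, of k] rL(1)
    by (simp add: g_def z_def dist_norm norm_minus_commute)
  have z0: "(\<lambda>k. z k t) \<longlonglongrightarrow> 0" if t: "t \<in> {a..b}" for t
  proof (rule Lim_null_comparison)
    show "eventually (\<lambda>k. norm (z k t) \<le> M * (1 / real (Suc k))) sequentially"
    proof (intro always_eventually allI)
      fix k
      have "norm (z k t) \<le> M * norm (Y k - x)" by (rule zM) (use t in auto)
      also have "\<dots> \<le> M * (1 / real (Suc k))"
        using Y(1)[of k] M(2) by (intro mult_left_mono) auto
      finally show "norm (z k t) \<le> M * (1 / real (Suc k))" .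
    qed
    show "(\<lambda>k. M * (1 / real (Suc k))) \<longlonglongrightarrow> 0"
      using tendsto_mult_left[OF lim_1_over_n[THEN LIMSEQ_Suc], of M] by simp
  qed
  obtain N where N: "countable N"
    "\<And>t s w. t \<notin> N \<Longrightarrow> t0 \<le> s \<Longrightarrow> s \<le> t \<Longrightarrow> continuous (at t within {s..}) w
      \<Longrightarrow> continuous (at t within {s..}) (\<lambda>\<tau>. f \<tau> (w \<tau>))"
    using exceptional_times by blast
  obtain E where E: "E > 0" "\<And>t. t \<in> {a..b} \<Longrightarrow> exp (- c * t) \<le> E"
    using exp_lipschitz_on_interval[of a b c] by blast
  \<comment> \<open>Division by the initial distance \<open>\<eta> k\<close> keeps the integrands
    bounded while \<open>Y k\<close> tends to \<open>x\<close>. By \<open>dd\<close> the linear part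
    contributes at most 0, so \<open>m\<close> is below the scaled linearisation error
    \<open>e\<close>.\<close>
  define m where "m k t = exp (- c * t) * (norm_dd G (z k t) (g k t) - c * G (z k t)) / \<eta> k" for k t
  define rest where "rest k t = g k t - jacobian (f t) (at (X t)) *v z k t" for k t
  define e where "e k t = exp (- c * t) * G (rest k t) / \<eta> k" for k t
  have mint: "(m k has_integral (exp (- c * b) * G (z k b) / \<eta> k - exp (- c * a))) {a..b}" for k
  proof -
    have "((\<lambda>t. exp (- c * t) * (norm_dd G (V k t - X t) (f t (V k t) - f t (X t)) - c * G (V k t - X t)))
        has_integral (exp (- c * b) * G (V k b - X b) - exp (- c * a) * G (Y k - x))) {a..b}"
    proof (rule norm_difference_integral[OF G sX sV a N(1)])
      show "continuous (at t within {a..}) (\<lambda>\<tau>. f \<tau> (w \<tau>))"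
        if "t \<notin> N" "a \<le> t" "continuous (at t within {a..}) w" for t w
        using N(2)[OF that(1) a(1) that(2,3)] .
      fix t assume t: "t \<in> {a..b + 1}"
      show "norm (V k t - X t) \<le> r" using zr[OF t] by (simp add: z_def)
      have "norm (g k t) \<le> L * r" using gL[OF t, of k] zr[OF t, of k] rL(2) by (meson mult_left_mono order_trans)
      then show "norm (f t (V k t) - f t (X t)) \<le> L * r" by (simp add: g_def)
    qed
    from has_integral_divide[OF this, of "\<eta> k"] show ?thesis
      using \<eta>[of k] by (simp add: m_def[abs_def] z_def g_def diff_divide_distrib \<eta>_def[symmetric])
  qed
  have mbound: "\<bar>m k t\<bar> \<le> E * (CG * (L * (M / cg)) + \<bar>c\<bar> * (CG * (M / cg)))" if t: "t \<in> {a..b} - N" for k t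
  proof -
    have t1: "t \<in> {a..b + 1}" using t by auto
    have Gz: "G (z k t) \<le> CG * (M / cg * \<eta> k)"
      using CG(2)[of "z k t"] z\<eta>[OF t1, of k] CG(1) by (meson mult_left_mono less_imp_le order_trans)
    have "G (g k t) \<le> CG * (L * (M / cg * \<eta> k))"
    proof -
      have "norm (g k t) \<le> L * (M / cg * \<eta> k)"
        using gL[OF t1, of k] z\<eta>[OF t1, of k] rL(2) by (meson mult_left_mono order_trans)
      then show ?thesis using CG(2)[of "g k t"] CG(1) by (meson mult_left_mono less_imp_le order_trans)
    qed
    then have 1: "\<bar>norm_dd G (z k t) (g k t)\<bar> \<le> CG * (L * (M / cg * \<eta> k))"
      using norm_dd_bounds[OF G, of "z k t" "g k t"] by simp
    have 2: "\<bar>c * G (z k t)\<bar> \<le> \<bar>c\<bar> * (CG * (M / cg * \<eta> k))"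
      using mult_left_mono[OF Gz, of "\<bar>c\<bar>"] norm_onD(1)[OF G, of "z k t"] by (simp add: abs_mult)
    have "\<bar>norm_dd G (z k t) (g k t) - c * G (z k t)\<bar>
        \<le> (CG * (L * (M / cg)) + \<bar>c\<bar> * (CG * (M / cg))) * \<eta> k"
      using 1 2 by (simp add: algebra_simps)
    then have "\<bar>norm_dd G (z k t) (g k t) - c * G (z k t)\<bar> / \<eta> k
        \<le> CG * (L * (M / cg)) + \<bar>c\<bar> * (CG * (M / cg))"
      using \<eta>[of k] by (simp only: pos_divide_le_eq)
    then have "exp (- c * t) * (\<bar>norm_dd G (z k t) (g k t) - c * G (z k t)\<bar> / \<eta> k)
        \<le> E * (CG * (L * (M / cg)) + \<bar>c\<bar> * (CG * (M / cg)))"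
      using E t \<eta>[of k] by (intro mult_mono) auto
    then show ?thesis using \<eta>[of k] by (simp add: m_def abs_mult)
  qed
  have mle: "m k t \<le> e k t" if t: "t \<in> {a..b} - N" for k t
  proof -
    have "norm_dd G (z k t) (g k t) \<le> norm_dd G (z k t) (jacobian (f t) (at (X t)) *v z k t) + G (rest k t)"
      using norm_dd_add_le[OF G, of "z k t" "jacobian (f t) (at (X t)) *v z k t" "rest k t"] by (simp add: rest_def)
    also have "\<dots> \<le> c * G (z k t) + G (rest k t)" using dd[of t "z k t"] t by (simp add: X_def)
    finally have "norm_dd G (z k t) (g k t) - c * G (z k t) \<le> G (rest k t)" by simp
    then show ?thesis
      unfolding m_def e_def using \<eta>[of k] by (intro divide_right_mono mult_left_mono) auto
  qed
  have e0: "(\<lambda>k. e k t) \<longlonglongrightarrow> 0" if t: "t \<in> {a..b} - N" for t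
  proof (rule LIMSEQ_I)
    fix \<epsilon> :: real assume \<epsilon>: "\<epsilon> > 0"
    \<comment> \<open>\<open>S\<close> bounds the constants that multiply the linearisation error,
      so the tolerance \<open>\<kappa>\<close> for the derivative leaves a total of at most
      \<open>\<epsilon> / 2\<close>; the summand 1 keeps \<open>S\<close> positive.\<close>
    define S where "S = E * CG * (M / cg) + 1"
    define \<kappa> where "\<kappa> = \<epsilon> / (2 * S)"
    have "E * CG * (M / cg) \<ge> 0" using E CG M cg by simp
    then have S: "S > 0" by (simp add: S_def)
    have \<kappa>: "\<kappa> > 0" using \<epsilon> S by (simp add: \<kappa>_def)
    have "(f t has_derivative (\<lambda>h. jacobian (f t) (at (X t)) *v h)) (at (X t))"
      using diff[of t] t jacobian_works unfolding X_def by blast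
    then obtain d where d: "d > 0" "\<And>y. norm (y - X t) < d \<Longrightarrow>
        norm (f t y - f t (X t) - jacobian (f t) (at (X t)) *v (y - X t)) \<le> \<kappa> * norm (y - X t)"
      using \<kappa> unfolding has_derivative_at_alt by blast
    have "eventually (\<lambda>k. norm (z k t) < d) sequentially"
      using z0[of t] t d(1) by (auto simp: tendsto_iff dist_norm)
    then obtain k0 where k0: "\<And>k. k \<ge> k0 \<Longrightarrow> norm (z k t) < d" by (auto simp: eventually_sequentially)
    have "norm (e k t - 0) < \<epsilon>" if "k \<ge> k0" for k
    proof -
      have "norm (rest k t) \<le> \<kappa> * norm (z k t)"
        using d(2)[of "V k t"] k0[OF that] by (simp add: rest_def g_def z_def)
      also have "\<dots> \<le> \<kappa> * (M / cg * \<eta> k)" using z\<eta>[of t k] t \<kappa> by (intro mult_left_mono) auto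
      finally have "norm (rest k t) \<le> \<kappa> * (M / cg * \<eta> k)" .
      then have "CG * norm (rest k t) \<le> CG * (\<kappa> * (M / cg * \<eta> k))"
        by (rule mult_left_mono) (use CG(1) in simp)
      then have "G (rest k t) / \<eta> k \<le> CG * (\<kappa> * (M / cg))"
        using CG(2)[of "rest k t"] \<eta>[of k] by (simp add: pos_divide_le_eq mult.assoc)
      then have "exp (- c * t) * (G (rest k t) / \<eta> k) \<le> E * (CG * (\<kappa> * (M / cg)))"
        using E t \<eta>[of k] norm_onD(1)[OF G, of "rest k t"] by (intro mult_mono) auto
      also have "\<dots> = \<kappa> * (E * CG * (M / cg))" by simp
      also have "\<dots> \<le> \<kappa> * S" using \<kappa> by (intro mult_left_mono) (auto simp: S_def)
      also have "\<dots> = \<epsilon> / 2" using S by (simp add: \<kappa>_def)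
      also have "\<dots> < \<epsilon>" using \<epsilon> by simp
      finally have "e k t < \<epsilon>" by (simp add: e_def)
      moreover have "0 \<le> e k t" using norm_onD(1)[OF G, of "rest k t"] \<eta>[of k] by (simp add: e_def)
      ultimately show ?thesis by simp
    qed
    then show "\<exists>k0. \<forall>k\<ge>k0. norm (e k t - 0) < \<epsilon>" by blast
  qed
  \<comment> \<open>An excess of one half suffices: the expansion ratio is then at most 3/2 times
    the exponential, below the factor 2 that \<open>Y\<close> was chosen to exceed.\<close>
  have "eventually (\<lambda>k. integral {a..b} (m k) \<le> exp (- c * a) / 2) sequentially"
    by (rule integral_eventually_le[OF N(1) has_integral_integrable[OF mint] mbound mle e0]) simp_all
  then obtain k where k: "integral {a..b} (m k) \<le> exp (- c * a) / 2"
    by (auto simp: eventually_sequentially)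
  have "exp (- c * b) * G (z k b) / \<eta> k - exp (- c * a) \<le> exp (- c * a) / 2"
    using k integral_unique[OF mint] by simp
  then have "exp (- c * b) * G (z k b) / \<eta> k \<le> 2 * exp (- c * a)"
    using exp_ge_zero[of "- c * a"] by linarith
  then have "exp (- c * b) * G (z k b) \<le> 2 * exp (- c * a) * \<eta> k"
    using \<eta>[of k] by (simp add: pos_divide_le_eq)
  then have "exp (c * b) * (exp (- c * b) * G (z k b)) \<le> exp (c * b) * (2 * exp (- c * a) * \<eta> k)"
    by (rule mult_left_mono) simp
  moreover have "exp (c * b) * (exp (- c * b) * G (z k b)) = G (z k b)"
    by (simp add: mult.assoc[symmetric] exp_add[symmetric])
  moreover have "exp (c * b) * (2 * exp (- c * a) * \<eta> k) = 2 * exp (c * (b - a)) * \<eta> k"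
    by (simp add: exp_diff exp_minus right_diff_distrib divide_inverse)
  ultimately have "G (z k b) \<le> 2 * exp (c * (b - a)) * \<eta> k" by (simp only:)
  then show False using Y(2)[of k] by (simp add: z_def V_def X_def \<eta>_def)
qed

text \<open>The neighbourhood in \<open>expansion_at_point\<close> depends on the point and on
  \<open>T\<close>, but along a segment the bound is proportional to the parameter step, hence
  additive, and bisection passes from short steps to the whole segment. Two times occur because
  \<open>C\<close> is convex as a set of states at \<open>t1\<close>, whereas the growth bound
  starts at \<open>t2\<close>, where the image of \<open>C\<close> need not be convex.\<close>

lemma expansion_on_convex:
  assumes G: "norm_on UNIV G" and C: "compact C" "convex C" and t: "t0 \<le> t1" "t1 \<le> t2"
    and diff: "\<And>t v. t2 \<le> t \<Longrightarrow> v \<in> C \<Longrightarrow> f t differentiable (at (sol f t t1 v))"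
    and dd: "\<And>t v z. t2 \<le> t \<Longrightarrow> v \<in> C \<Longrightarrow> norm_dd G z (jacobian (f t) (at (sol f t t1 v)) *v z) \<le> c * G z"
  shows "\<exists>B\<ge>0. \<forall>T\<ge>t2. \<forall>v\<in>C. \<forall>w\<in>C.
    G (sol f T t1 w - sol f T t1 v) \<le> B * exp (c * (T - t2)) * G (w - v)"
proof -
  obtain \<delta> M where M: "\<delta> > 0" "M \<ge> 0"
    "\<And>x y. x \<in> C \<Longrightarrow> norm (y - x) < \<delta> \<Longrightarrow> norm (sol f t2 t1 y - sol f t2 t1 x) \<le> M * norm (y - x)"
    using sol_lipschitz_near[OF C(1) t] t(2) by (auto dest: bspec)
  obtain CG where CG: "CG > 0" "\<And>v. G v \<le> CG * norm v" using norm_on_upper[OF G subspace_UNIV] by auto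
  obtain cg where cg: "cg > 0" "\<And>v. cg * norm v \<le> G v" using norm_on_lower[OF G subspace_UNIV] by auto
  \<comment> \<open>\<open>M\<close> bounds the flow from \<open>t1\<close> to \<open>t2\<close>,
    \<open>CG / cg\<close> pays for measuring it in the Euclidean norm, and 2 comes from
    \<open>expansion_at_point\<close>.\<close>
  define B where "B = 2 * (CG * (M / cg))"
  have B0: "B \<ge> 0" using M CG cg by (simp add: B_def)
  have main: "G (sol f T t1 w - sol f T t1 v) \<le> B * exp (c * (T - t2)) * G (w - v)"
    if T: "T \<ge> t2" and vw: "v \<in> C" "w \<in> C" for T v w
  proof -
    define \<gamma> where "\<gamma> \<sigma> = v + \<sigma> *\<^sub>R (w - v)" for \<sigma>
    define A where "A = B * exp (c * (T - t2)) * G (w - v)"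
    define P where "P a b \<longleftrightarrow> (0 \<le> a \<longrightarrow> b \<le> 1 \<longrightarrow> G (sol f T t1 (\<gamma> b) - sol f T t1 (\<gamma> a)) \<le> A * (b - a))" for a b
    have \<gamma>C: "\<gamma> \<sigma> \<in> C" if "0 \<le> \<sigma>" "\<sigma> \<le> 1" for \<sigma>
    proof -
      have "\<gamma> \<sigma> = (1 - \<sigma>) *\<^sub>R v + \<sigma> *\<^sub>R w" by (simp add: \<gamma>_def algebra_simps)
      then show ?thesis using convexD_alt[OF C(2) vw that] by simp
    qed
    have "P 0 1"
    proof (rule Bolzano)
      fix a b d assume P: "P a b" "P b d" "a \<le> b" "b \<le> d"
      show "P a d" unfolding P_def
      proof (intro impI)
        assume "0 \<le> a" "d \<le> 1"
        then have "G (sol f T t1 (\<gamma> b) - sol f T t1 (\<gamma> a)) \<le> A * (b - a)"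
          "G (sol f T t1 (\<gamma> d) - sol f T t1 (\<gamma> b)) \<le> A * (d - b)" using P by (auto simp: P_def)
        moreover have "G (sol f T t1 (\<gamma> d) - sol f T t1 (\<gamma> a))
            \<le> G (sol f T t1 (\<gamma> d) - sol f T t1 (\<gamma> b)) + G (sol f T t1 (\<gamma> b) - sol f T t1 (\<gamma> a))"
          using norm_onD(4)[OF G, of "sol f T t1 (\<gamma> d) - sol f T t1 (\<gamma> b)" "sol f T t1 (\<gamma> b) - sol f T t1 (\<gamma> a)"] by simp
        ultimately show "G (sol f T t1 (\<gamma> d) - sol f T t1 (\<gamma> a)) \<le> A * (d - a)"
          by (simp add: algebra_simps)
      qed
    next
      fix \<sigma> :: real assume \<sigma>: "0 \<le> \<sigma>" "\<sigma> \<le> 1"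
      define x where "x = sol f t2 t1 (\<gamma> \<sigma>)"
      have semi: "sol f \<tau> t2 (sol f t2 t1 p) = sol f \<tau> t1 p" if "t2 \<le> \<tau>" for \<tau> p
        using sol_semigroup[OF t that] .
      obtain \<delta>' where \<delta>': "\<delta>' > 0" "\<And>y. norm (y - x) < \<delta>' \<Longrightarrow>
          G (sol f T t2 y - sol f T t2 x) \<le> 2 * exp (c * (T - t2)) * G (y - x)"
      proof -
        have "\<exists>\<delta>>0. \<forall>y. norm (y - x) < \<delta> \<longrightarrow>
          G (sol f T t2 y - sol f T t2 x) \<le> 2 * exp (c * (T - t2)) * G (y - x)"
          by (rule expansion_at_point[OF G _ T])
             (use t diff dd \<gamma>C[OF \<sigma>] semi in \<open>auto simp: x_def\<close>)
        then show ?thesis using that by blast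
      qed
      define nw where "nw = norm (w - v)"
      \<comment> \<open>The first term brings \<open>\<gamma> s\<close> within reach of the estimate
        from \<open>t1\<close> to \<open>t2\<close>, the second brings its image at
        \<open>t2\<close> within reach of the one from \<open>t2\<close> to \<open>T\<close>. The
        summands 1 avoid zero denominators.\<close>
      define d where "d = min (\<delta> / (nw + 1)) (\<delta>' / (M * nw + 1))"
      have nw: "nw \<ge> 0" by (simp add: nw_def)
      have Mnw: "M * nw \<ge> 0" using M nw by simp
      have d0: "d > 0" using M \<delta>' nw Mnw by (simp add: d_def add_nonneg_pos)
      have close: "G (sol f T t1 (\<gamma> s) - sol f T t1 (\<gamma> \<sigma>)) \<le> A * \<bar>s - \<sigma>\<bar>" if s: "\<bar>s - \<sigma>\<bar> < d" for s
      proof -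
        have eq: "norm (\<gamma> s - \<gamma> \<sigma>) = \<bar>s - \<sigma>\<bar> * nw"
        proof -
          have "\<gamma> s - \<gamma> \<sigma> = (s - \<sigma>) *\<^sub>R (w - v)" by (simp add: \<gamma>_def algebra_simps)
          then show ?thesis by (simp add: nw_def)
        qed
        have "\<bar>s - \<sigma>\<bar> * (nw + 1) < \<delta>" using s nw by (simp add: d_def field_simps)
        then have "norm (\<gamma> s - \<gamma> \<sigma>) < \<delta>" using eq by (simp add: algebra_simps)
        then have 1: "norm (sol f t2 t1 (\<gamma> s) - x) \<le> M * (\<bar>s - \<sigma>\<bar> * nw)"
          unfolding x_def using M(3)[OF \<gamma>C[OF \<sigma>], of "\<gamma> s"] eq by simp
        have "\<bar>s - \<sigma>\<bar> * (M * nw + 1) < \<delta>'" using s Mnw by (simp add: d_def pos_less_divide_eq add_nonneg_pos)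
        then have "norm (sol f t2 t1 (\<gamma> s) - x) < \<delta>'" using 1 by (simp add: algebra_simps)
        then have "G (sol f T t1 (\<gamma> s) - sol f T t1 (\<gamma> \<sigma>)) \<le> 2 * exp (c * (T - t2)) * G (sol f t2 t1 (\<gamma> s) - x)"
          using \<delta>'(2)[of "sol f t2 t1 (\<gamma> s)"] semi[OF T] by (simp add: x_def)
        also have "\<dots> \<le> 2 * exp (c * (T - t2)) * (CG * (M * (\<bar>s - \<sigma>\<bar> * (G (w - v) / cg))))"
        proof (rule mult_left_mono)
          have "nw \<le> G (w - v) / cg" using cg(1) cg(2)[of "w - v"] by (simp add: nw_def field_simps)
          then have "M * (\<bar>s - \<sigma>\<bar> * nw) \<le> M * (\<bar>s - \<sigma>\<bar> * (G (w - v) / cg))"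
            using M by (intro mult_left_mono) auto
          then have "CG * norm (sol f t2 t1 (\<gamma> s) - x) \<le> CG * (M * (\<bar>s - \<sigma>\<bar> * (G (w - v) / cg)))"
            using 1 CG(1) by (intro mult_left_mono) auto
          then show "G (sol f t2 t1 (\<gamma> s) - x) \<le> CG * (M * (\<bar>s - \<sigma>\<bar> * (G (w - v) / cg)))"
            using CG(2)[of "sol f t2 t1 (\<gamma> s) - x"] by simp
        qed simp
        also have "\<dots> = A * \<bar>s - \<sigma>\<bar>" by (simp add: A_def B_def)
        finally show ?thesis .
      qed
      show "\<exists>d>0. \<forall>a b. a \<le> \<sigma> \<and> \<sigma> \<le> b \<and> b - a < d \<longrightarrow> P a b"
      proof (intro exI[of _ d] conjI allI impI d0)
        fix a b assume ab: "a \<le> \<sigma> \<and> \<sigma> \<le> b \<and> b - a < d"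
        have "G (sol f T t1 (\<gamma> b) - sol f T t1 (\<gamma> a))
            \<le> G (sol f T t1 (\<gamma> b) - sol f T t1 (\<gamma> \<sigma>)) + G (sol f T t1 (\<gamma> \<sigma>) - sol f T t1 (\<gamma> a))"
          using norm_onD(4)[OF G, of "sol f T t1 (\<gamma> b) - sol f T t1 (\<gamma> \<sigma>)" "sol f T t1 (\<gamma> \<sigma>) - sol f T t1 (\<gamma> a)"] by simp
        also have "G (sol f T t1 (\<gamma> \<sigma>) - sol f T t1 (\<gamma> a)) = G (sol f T t1 (\<gamma> a) - sol f T t1 (\<gamma> \<sigma>))"
          by (rule norm_on_minus_commute[OF G])
        also have "G (sol f T t1 (\<gamma> b) - sol f T t1 (\<gamma> \<sigma>)) + G (sol f T t1 (\<gamma> a) - sol f T t1 (\<gamma> \<sigma>)) \<le> A * (b - a)"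
          using close[of b] close[of a] ab by (simp add: algebra_simps)
        finally show "P a b" by (simp add: P_def)
      qed
    qed simp
    then show ?thesis by (simp add: P_def \<gamma>_def A_def)
  qed
  then show ?thesis using B0 by blast
qed

end

section \<open>Covering numbers and topological entropy\<close>

text \<open>Space is cut into cells of side \<open>\<rho> / n\<close>, with \<open>n\<close> the
  dimension, so that two points of one cell are closer than \<open>\<rho>\<close> even in the sum
  norm. Centres have to belong to \<open>K\<close>, so a point of \<open>K\<close> is picked from
  each cell that meets \<open>K\<close>.\<close>

lemma compact_covering_number:
  fixes K :: "(real ^ 'n) set"
  assumes K: "compact K"
  shows "\<exists>C>0. \<forall>\<rho>. 0 < \<rho> \<longrightarrow> \<rho> \<le> 1 \<longrightarrow>
    (\<exists>E. finite E \<and> E \<subseteq> K \<and> K \<subseteq> (\<Union>x\<in>E. ball x \<rho>) \<and> real (card E) \<le> C * (1 / \<rho>) ^ CARD('n))"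
proof -
  obtain B where B: "B > 0" "\<And>x. x \<in> K \<Longrightarrow> norm x \<le> B"
    using compact_imp_bounded[OF K] bounded_pos by metis
  define n where "n = real CARD('n)"
  have n: "n > 0" by (simp add: n_def)
  \<comment> \<open>Indices run from \<open>- m\<close> to \<open>m\<close>, and
    \<open>2 * m + 1\<close> is at most \<open>2 * B * n / \<rho> + 3\<close>; as
    \<open>\<rho> \<le> 1\<close>, the 3 may be enlarged to \<open>3 / \<rho>\<close>.\<close>
  define C where "C = (2 * B * n + 3) ^ CARD('n)"
  have "\<exists>E. finite E \<and> E \<subseteq> K \<and> K \<subseteq> (\<Union>x\<in>E. ball x \<rho>) \<and> real (card E) \<le> C * (1 / \<rho>) ^ CARD('n)"
    if \<rho>: "0 < \<rho>" "\<rho> \<le> 1" for \<rho>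
  proof -
    define idx where "idx x i = \<lfloor>x $ i * (n / \<rho>)\<rfloor>" for x :: "real ^ 'n" and i
    define m where "m = \<lceil>B * (n / \<rho>)\<rceil>"
    have "0 \<le> B * (n / \<rho>)" using B n \<rho> by simp
    then have m0: "0 \<le> m" unfolding m_def by linarith
    have range: "idx x i \<in> {- m..m}" if "x \<in> K" for x i
    proof -
      have "\<bar>x $ i\<bar> \<le> B" using component_le_norm_cart[of x i] B(2)[OF that] by simp
      then have "\<bar>x $ i * (n / \<rho>)\<bar> \<le> B * (n / \<rho>)"
        using n \<rho> by (simp add: abs_mult mult_right_mono divide_right_mono)
      also have "\<dots> \<le> of_int m" by (simp add: m_def)
      finally have "- of_int m \<le> x $ i * (n / \<rho>)" "x $ i * (n / \<rho>) \<le> of_int m"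
        unfolding abs_le_iff by linarith+
      then show ?thesis unfolding idx_def
        by (auto simp: le_floor_iff floor_le_iff)
    qed
    have sub: "idx ` K \<subseteq> PiE UNIV (\<lambda>_. {- m..m})" using range by (auto simp: PiE_def Pi_def)
    have fin: "finite (PiE (UNIV :: 'n set) (\<lambda>_. {- m..m}))" by (intro finite_PiE) auto
    have card: "real (card (idx ` K)) \<le> C * (1 / \<rho>) ^ CARD('n)"
    proof -
      have "card (idx ` K) \<le> card (PiE (UNIV :: 'n set) (\<lambda>_. {- m..m}))" by (rule card_mono[OF fin sub])
      also have "\<dots> = nat (2 * m + 1) ^ CARD('n)" by (simp add: card_PiE)
      finally have "real (card (idx ` K)) \<le> real (nat (2 * m + 1)) ^ CARD('n)"
        by (metis of_nat_le_iff of_nat_power)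
      also have "\<dots> \<le> ((2 * B * n + 3) * (1 / \<rho>)) ^ CARD('n)"
      proof (rule power_mono)
        have "real_of_int m \<le> B * (n / \<rho>) + 1" unfolding m_def by linarith
        then have "real (nat (2 * m + 1)) \<le> 2 * (B * (n / \<rho>)) + 3" using m0 by simp
        also have "\<dots> \<le> 2 * (B * (n / \<rho>)) + 3 * (1 / \<rho>)"
          using \<rho> pos_le_divide_eq[of \<rho> 3 3] by simp
        also have "\<dots> = (2 * B * n + 3) * (1 / \<rho>)" by (simp add: algebra_simps)
        finally show "real (nat (2 * m + 1)) \<le> (2 * B * n + 3) * (1 / \<rho>)" .
      qed simp
      finally show ?thesis by (simp add: C_def power_mult_distrib power_divide)
    qed
    define pick where "pick c = (SOME x. x \<in> K \<and> idx x = c)" for c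
    have pick: "pick (idx x) \<in> K \<and> idx (pick (idx x)) = idx x" if "x \<in> K" for x
      unfolding pick_def using someI[of "\<lambda>y. y \<in> K \<and> idx y = idx x" x] that by blast
    define E where "E = pick ` idx ` K"
    have fini: "finite (idx ` K)" using finite_subset[OF sub fin] .
    have near: "dist y x < \<rho>" if "idx y = idx x" for x y
    proof -
      have "\<bar>(y - x) $ i\<bar> < \<rho> / n" for i
      proof -
        have "\<bar>y $ i * (n / \<rho>) - x $ i * (n / \<rho>)\<bar> < 1"
          using that fun_cong[OF that, of i] unfolding idx_def by linarith
        also have "y $ i * (n / \<rho>) - x $ i * (n / \<rho>) = (y - x) $ i * (n / \<rho>)"
          by (simp only: vector_minus_component left_diff_distrib)
        finally have "\<bar>(y - x) $ i\<bar> * (n / \<rho>) < 1" using n \<rho> by (simp add: abs_mult)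
        then show ?thesis using n \<rho> by (simp add: field_simps)
      qed
      then have "(\<Sum>i\<in>UNIV. \<bar>(y - x) $ i\<bar>) < (\<Sum>i\<in>(UNIV :: 'n set). \<rho> / n)"
        by (intro sum_strict_mono) auto
      also have "\<dots> = \<rho>" by (simp add: n_def)
      finally show ?thesis using norm_le_l1_cart[of "y - x"] by (simp add: dist_norm)
    qed
    have "finite E" using fini by (simp add: E_def)
    moreover have "E \<subseteq> K" using pick by (auto simp: E_def)
    moreover have "K \<subseteq> (\<Union>x\<in>E. ball x \<rho>)"
    proof
      fix x assume x: "x \<in> K"
      have "pick (idx x) \<in> E" using x by (simp add: E_def)
      moreover have "x \<in> ball (pick (idx x)) \<rho>" using near pick[OF x] by simp
      ultimately show "x \<in> (\<Union>x\<in>E. ball x \<rho>)" by blast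
    qed
    moreover have "real (card E) \<le> C * (1 / \<rho>) ^ CARD('n)"
      using card_image_le[OF fini, of pick] card by (simp add: E_def)
    ultimately show ?thesis by blast
  qed
  moreover have "C > 0" using B n by (simp add: C_def add_pos_pos)
  ultimately show ?thesis by blast
qed

section \<open>Spanning numbers and the limit defining the entropy\<close>

lemma ln_real_nat_mono: "m \<le> n \<Longrightarrow> ln (real m) \<le> ln (real n)"
  by (cases "m = 0"; cases "n = 0") auto

lemma span_number_le:
  assumes "finite E" "spanning p f t0 \<epsilon> T K E"
  shows "span_number p f t0 \<epsilon> T K \<le> card E"
  unfolding span_number_def by (rule cINF_lower) (use assms in auto)

text \<open>An infimum of naturals is informative only over a nonempty set. One finite spanning set
  for \<open>\<epsilon>1\<close> makes the minimum attained, and a minimiser still spans for the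
  larger radius.\<close>

lemma span_number_antimono:
  assumes "\<epsilon>1 \<le> \<epsilon>2" and "finite E" "spanning p f t0 \<epsilon>1 T K E"
  shows "span_number p f t0 \<epsilon>2 T K \<le> span_number p f t0 \<epsilon>1 T K"
proof -
  let ?S = "{E. finite E \<and> spanning p f t0 \<epsilon>1 T K E}"
  have "span_number p f t0 \<epsilon>1 T K \<in> card ` ?S"
    unfolding span_number_def by (rule Inf_nat_def1) (use assms in auto)
  then obtain F where F: "finite F" "spanning p f t0 \<epsilon>1 T K F" "card F = span_number p f t0 \<epsilon>1 T K" by auto
  have "dyn_ball p f t0 x \<epsilon>1 T \<subseteq> dyn_ball p f t0 x \<epsilon>2 T" for x
    using assms(1) by (auto simp: dyn_ball_def)
  then have "spanning p f t0 \<epsilon>2 T K F" using F(2) unfolding spanning_def by blast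
  then show ?thesis using span_number_le F by metis
qed

lemma tendsto_SUP_at_right_0:
  fixes F :: "real \<Rightarrow> ereal"
  assumes anti: "\<And>x y. 0 < x \<Longrightarrow> x \<le> y \<Longrightarrow> F y \<le> F x"
  shows "(F \<longlongrightarrow> (SUP x\<in>{0<..}. F x)) (at_right 0)"
proof (rule order_tendstoI)
  fix y assume "y < (SUP x\<in>{0<..}. F x)"
  then obtain x where x: "x > 0" "y < F x" by (auto simp: less_SUP_iff)
  show "eventually (\<lambda>x. y < F x) (at_right 0)"
    by (rule eventually_at_rightI[of 0 x]) (use x anti in \<open>auto intro: less_le_trans\<close>)
next
  fix y assume y: "(SUP x\<in>{0<..}. F x) < y"
  show "eventually (\<lambda>x. F x < y) (at_right 0)"
    by (rule eventually_at_rightI[of 0 1]) (use y in \<open>auto intro: le_less_trans[OF SUP_upper]\<close>)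
qed

text \<open>Exhibiting finite spanning sets also makes the growth rate antitone in \<open>\<epsilon>\<close>, so that the
  limit defining the entropy exists.\<close>
lemma top_entropy_le:
  assumes fin: "\<And>\<epsilon>. \<epsilon> > 0 \<Longrightarrow> \<exists>C\<ge>1. \<forall>T\<ge>0. \<exists>E. finite E \<and> spanning p f t0 \<epsilon> T K E \<and> real (card E) \<le> C * exp (b * T)"
    and b: "0 \<le> b"
  shows "top_entropy p f t0 K \<le> ereal b"
proof -
  define F where "F \<epsilon> = Limsup at_top (\<lambda>T::real. ereal (1 / T * ln (real (span_number p f t0 \<epsilon> T K))))" for \<epsilon>
  have anti: "F \<epsilon>2 \<le> F \<epsilon>1" if \<epsilon>: "0 < \<epsilon>1" "\<epsilon>1 \<le> \<epsilon>2" for \<epsilon>1 \<epsilon>2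
    unfolding F_def
  proof (rule Limsup_mono, rule eventually_mono[OF eventually_gt_at_top[of 0]])
    fix T :: real assume T: "0 < T"
    obtain E where "finite E" "spanning p f t0 \<epsilon>1 T K E" using fin[OF \<epsilon>(1)] T by (meson less_imp_le)
    then have "span_number p f t0 \<epsilon>2 T K \<le> span_number p f t0 \<epsilon>1 T K" by (rule span_number_antimono[OF \<epsilon>(2)])
    then have "ln (real (span_number p f t0 \<epsilon>2 T K)) \<le> ln (real (span_number p f t0 \<epsilon>1 T K))"
      by (rule ln_real_nat_mono)
    then show "ereal (1 / T * ln (real (span_number p f t0 \<epsilon>2 T K))) \<le> ereal (1 / T * ln (real (span_number p f t0 \<epsilon>1 T K)))"
      unfolding ereal_less_eq(3) using T by (intro mult_left_mono) auto
  qed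
  have le: "F \<epsilon> \<le> ereal b" if \<epsilon>: "0 < \<epsilon>" for \<epsilon>
  proof -
    obtain C where C: "C \<ge> 1" "\<And>T. 0 \<le> T \<Longrightarrow> \<exists>E. finite E \<and> spanning p f t0 \<epsilon> T K E \<and> real (card E) \<le> C * exp (b * T)"
      using fin[OF \<epsilon>] by blast
    have "F \<epsilon> \<le> Limsup at_top (\<lambda>T::real. ereal (ln C * inverse T + b))"
      unfolding F_def
    proof (rule Limsup_mono, rule eventually_mono[OF eventually_gt_at_top[of 0]])
      fix T :: real assume T: "0 < T"
      let ?s = "span_number p f t0 \<epsilon> T K"
      obtain E where E: "finite E" "spanning p f t0 \<epsilon> T K E" "real (card E) \<le> C * exp (b * T)"
        using C(2)[of T] T by auto
      have "real ?s \<le> C * exp (b * T)" using span_number_le[OF E(1,2)] E(3) by linarith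
      \<comment> \<open>The number is 0 when \<open>K\<close> is empty; then \<open>ln 0 = 0\<close>
        and \<open>C \<ge> 1\<close> settle the estimate.\<close>
      have "ln (real ?s) \<le> ln C + b * T"
      proof (cases "?s = 0")
        case True
        then show ?thesis using C(1) b T by simp
      next
        case False
        then have "ln (real ?s) \<le> ln (C * exp (b * T))"
          using \<open>real ?s \<le> C * exp (b * T)\<close> by simp
        also have "\<dots> = ln C + b * T" using C(1) by (simp add: ln_mult)
        finally show ?thesis .
      qed
      then have "1 / T * ln (real ?s) \<le> 1 / T * (ln C + b * T)" using T by (intro mult_left_mono) auto
      also have "\<dots> = ln C * inverse T + b" using T by (simp add: field_simps)
      finally show "ereal (1 / T * ln (real ?s)) \<le> ereal (ln C * inverse T + b)" by simp
    qed
    also have "\<dots> = ereal b"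
    proof (rule lim_imp_Limsup)
      have "((\<lambda>T::real. ln C * inverse T + b) \<longlongrightarrow> ln C * 0 + b) at_top"
        by (intro tendsto_intros tendsto_inverse_0_at_top filterlim_ident)
      then show "((\<lambda>T::real. ereal (ln C * inverse T + b)) \<longlongrightarrow> ereal b) at_top" by simp
    qed simp
    finally show ?thesis .
  qed
  have "top_entropy p f t0 K = (SUP x\<in>{0<..}. F x)"
    unfolding top_entropy_def F_def[symmetric]
    by (rule tendsto_Lim[OF trivial_limit_at_right_real tendsto_SUP_at_right_0[OF anti]])
  also have "\<dots> \<le> ereal b" using le by (intro SUP_least) auto
  finally show ?thesis .
qed

text \<open>The exponential in the mesh cancels the expansion, and its power \<open>CARD('n)\<close>
  in the covering number produces the rate. The estimate \<open>expand\<close> is uniform over all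
  times up to \<open>t0 + T\<close>, as a dynamic ball requires.\<close>

lemma top_entropy_le_expansion:
  fixes f :: "real \<Rightarrow> real ^ 'n \<Rightarrow> real ^ 'n"
  assumes K: "compact K" and p: "norm_on UNIV p" and c: "0 \<le> c" and \<delta>: "\<delta> > 0"
    and expand: "\<And>x y T t. x \<in> K \<Longrightarrow> y \<in> K \<Longrightarrow> norm (y - x) < \<delta> \<Longrightarrow> t \<in> {t0..t0 + T} \<Longrightarrow>
      norm (sol f t t0 y - sol f t t0 x) \<le> B * exp (c * T) * norm (y - x)"
  shows "top_entropy p f t0 K \<le> ereal (real CARD('n) * c)"
proof (rule top_entropy_le)
  show "0 \<le> real CARD('n) * c" using c by simp
  fix \<epsilon> :: real assume \<epsilon>: "\<epsilon> > 0"
  obtain Cp where Cp: "Cp > 0" "\<And>v. p v \<le> Cp * norm v" using norm_on_upper[OF p subspace_UNIV] by auto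
  obtain CK where CK: "CK > 0"
    "\<And>\<rho>. 0 < \<rho> \<Longrightarrow> \<rho> \<le> 1 \<Longrightarrow> \<exists>E. finite E \<and> E \<subseteq> K \<and> K \<subseteq> (\<Union>x\<in>E. ball x \<rho>) \<and> real (card E) \<le> CK * (1 / \<rho>) ^ CARD('n)"
    using compact_covering_number[OF K] by blast
  \<comment> \<open>\<open>B\<close> may have any sign; \<open>B'\<close> is a positive bound for
    it.\<close>
  define B' where "B' = \<bar>B\<bar> + 1"
  \<comment> \<open>The bound 1 is for the covering lemma, \<open>\<delta>\<close> for
    \<open>expand\<close>, and the last term makes distances in \<open>p\<close> at most
    \<open>\<epsilon> / 2\<close>.\<close>
  define \<kappa> where "\<kappa> = min (min 1 \<delta>) (\<epsilon> / (2 * Cp * B'))"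
  have B': "B' > 0" "B \<le> B'" by (auto simp: B'_def)
  have \<kappa>: "\<kappa> > 0" "\<kappa> \<le> 1" "\<kappa> \<le> \<delta>" "Cp * (B' * \<kappa>) \<le> \<epsilon> / 2"
  proof -
    have "\<kappa> \<le> \<epsilon> / (2 * Cp * B')" by (simp add: \<kappa>_def)
    then have "\<kappa> * (2 * Cp * B') \<le> \<epsilon>" using Cp(1) B'(1) by (simp add: pos_le_divide_eq)
    then show "Cp * (B' * \<kappa>) \<le> \<epsilon> / 2" by (simp add: algebra_simps)
  qed (use \<epsilon> \<delta> Cp(1) B'(1) in \<open>auto simp: \<kappa>_def\<close>)
  define C where "C = CK * (1 / \<kappa>) ^ CARD('n) + 1"
  have "\<exists>E. finite E \<and> spanning p f t0 \<epsilon> T K E \<and> real (card E) \<le> C * exp (real CARD('n) * c * T)"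
    if T: "0 \<le> T" for T
  proof -
    define \<rho> where "\<rho> = \<kappa> * exp (- c * T)"
    have cT: "0 \<le> c * T" using c T by simp
    have \<rho>: "0 < \<rho>" "\<rho> \<le> \<kappa>" using \<kappa>(1) cT by (auto simp: \<rho>_def)
    obtain E where E: "finite E" "E \<subseteq> K" "K \<subseteq> (\<Union>x\<in>E. ball x \<rho>)" "real (card E) \<le> CK * (1 / \<rho>) ^ CARD('n)"
      using CK(2)[of \<rho>] \<rho> \<kappa> by auto
    have "spanning p f t0 \<epsilon> T K E"
      unfolding spanning_def
    proof (rule conjI[OF E(2) subsetI])
      fix y assume y: "y \<in> K"
      then obtain x where x: "x \<in> E" "norm (y - x) < \<rho>"
        using E(3) by (auto simp: dist_norm norm_minus_commute)
      \<comment> \<open>A dynamic ball asks for a supremum strictly below \<open>\<epsilon>\<close>,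
        which pointwise strict bounds would not give; hence the uniform bound
        \<open>\<epsilon> / 2\<close>.\<close>
      have "(SUP t\<in>{t0..t0 + T}. p (sol f t t0 y - sol f t t0 x)) \<le> \<epsilon> / 2"
      proof (rule cSUP_least)
        show "{t0..t0 + T} \<noteq> {}" using T by simp
        fix t assume t: "t \<in> {t0..t0 + T}"
        have "norm (sol f t t0 y - sol f t t0 x) \<le> B * exp (c * T) * norm (y - x)"
          by (rule expand[OF _ y _ t]) (use x E(2) \<rho> \<kappa> in auto)
        also have "\<dots> \<le> B' * exp (c * T) * \<rho>"
          using B' x(2) by (intro mult_mono) auto
        also have "\<dots> = B' * \<kappa>" by (simp add: \<rho>_def mult.assoc exp_add[symmetric])
        finally have "Cp * norm (sol f t t0 y - sol f t t0 x) \<le> Cp * (B' * \<kappa>)" using Cp(1) by simp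
        then show "p (sol f t t0 y - sol f t t0 x) \<le> \<epsilon> / 2"
          using Cp(2)[of "sol f t t0 y - sol f t t0 x"] \<kappa>(4) by linarith
      qed
      then have "y \<in> dyn_ball p f t0 x \<epsilon> T" using \<epsilon> by (simp add: dyn_ball_def)
      then show "y \<in> (\<Union>x\<in>E. dyn_ball p f t0 x \<epsilon> T)" using x(1) by blast
    qed
    moreover have "real (card E) \<le> C * exp (real CARD('n) * c * T)"
    proof -
      have "1 / \<rho> = 1 / \<kappa> * exp (c * T)" by (simp add: \<rho>_def exp_minus field_simps)
      then have "CK * (1 / \<rho>) ^ CARD('n) = CK * (1 / \<kappa>) ^ CARD('n) * exp (real CARD('n) * c * T)"
        by (simp only: power_mult_distrib exp_of_nat_mult[symmetric] mult.assoc)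
      also have "\<dots> \<le> C * exp (real CARD('n) * c * T)" by (intro mult_right_mono) (auto simp: C_def)
      finally show ?thesis using E(4) by simp
    qed
    ultimately show ?thesis using E(1) by blast
  qed
  moreover have "C \<ge> 1" using CK(1) \<kappa>(1) by (simp add: C_def)
  ultimately show "\<exists>C\<ge>1. \<forall>T\<ge>0. \<exists>E. finite E \<and> spanning p f t0 \<epsilon> T K E \<and> real (card E) \<le> C * exp (real CARD('n) * c * T)"
    by blast
qed

section \<open>The entropy bound\<close>

text \<open>The strict inequality for \<open>c\<close> provides a time \<open>t1\<close> and a later
  time after which the measure is at most \<open>c\<close> along all solutions that start in the
  hull at \<open>t1\<close>. Before that time, continuous dependence on the compact set
  \<open>K\<close> bounds the expansion by a constant.\<close>

lemma (in forward_complete_ode) top_entropy_le_asymp_measure: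
  fixes blk :: "'n \<Rightarrow> 'm::finite"
  assumes surj: "surj blk" and C1: "\<And>t. t \<ge> t0 \<Longrightarrow> C1_map (f t)"
    and l: "\<And>i. norm_on (block_space blk i) (lnrm i)" and p: "norm_on UNIV nnrm"
    and mono: "monotone_norm nnrm" and g: "norm_on UNIV gnrm" and K: "compact K"
    and c: "0 \<le> c" "asymp_measure blk lnrm nnrm f t0 K < ereal c"
  shows "top_entropy gnrm f t0 K \<le> ereal (real CARD('n) * c)"
proof -
  define G where "G = block_norm blk lnrm nnrm"
  have G: "norm_on UNIV G" unfolding G_def by (rule norm_on_block_norm[OF l p mono])
  obtain CG where CG: "CG > 0" "\<And>v. G v \<le> CG * norm v" using norm_on_upper[OF G subspace_UNIV] by auto
  obtain cg where cg: "cg > 0" "\<And>v. cg * norm v \<le> G v" using norm_on_lower[OF G subspace_UNIV] by auto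
  obtain t1 where t1: "t0 \<le> t1" and lim: "Limsup at_top (\<lambda>t. SUP v\<in>convex hull (sol f t1 t0 ` K).
      ereal (matrix_measure UNIV nnrm (interconnection_matrix blk lnrm f t (sol f t t1 v)))) < ereal c"
    using c(2) unfolding asymp_measure_def by (auto simp: INF_less_iff)
  define H where "H = convex hull (sol f t1 t0 ` K)"
  have H: "compact H" "convex H"
    unfolding H_def using K continuous_on_sol[OF order_refl t1, of K]
    by (auto intro: compact_convex_hull compact_continuous_image)
  obtain s where s: "\<And>t. s \<le> t \<Longrightarrow> (SUP v\<in>H.
      ereal (matrix_measure UNIV nnrm (interconnection_matrix blk lnrm f t (sol f t t1 v)))) < ereal c"
    using Limsup_lessD[OF lim] unfolding eventually_at_top_linorder H_def by blast
  define t2 where "t2 = max s t1"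
  have t2: "t1 \<le> t2" "t0 \<le> t2" using t1 by (auto simp: t2_def)
  have \<mu>: "matrix_measure UNIV nnrm (interconnection_matrix blk lnrm f t (sol f t t1 v)) \<le> c"
    if "t2 \<le> t" "v \<in> H" for t v
  proof -
    have "ereal (matrix_measure UNIV nnrm (interconnection_matrix blk lnrm f t (sol f t t1 v))) < ereal c"
      by (rule le_less_trans[OF SUP_upper[OF that(2)] s]) (use that(1) in \<open>simp add: t2_def\<close>)
    then show ?thesis by simp
  qed
  have "\<exists>B\<ge>0. \<forall>T\<ge>t2. \<forall>v\<in>H. \<forall>w\<in>H.
      G (sol f T t1 w - sol f T t1 v) \<le> B * exp (c * (T - t2)) * G (w - v)"
  proof (rule expansion_on_convex[OF G H t1 t2(1)])
    fix t v assume t: "t2 \<le> t" and v: "v \<in> H"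
    show "f t differentiable (at (sol f t t1 v))"
      using C1[of t] t t2(2) unfolding C1_map_def by simp
    show "norm_dd G z (jacobian (f t) (at (sol f t t1 v)) *v z) \<le> c * G z" for z
      unfolding G_def by (rule block_norm_dd_le[OF surj l p mono \<mu>[OF t v]])
  qed
  then obtain B where B: "B \<ge> 0" "\<And>T v w. t2 \<le> T \<Longrightarrow> v \<in> H \<Longrightarrow> w \<in> H \<Longrightarrow>
      G (sol f T t1 w - sol f T t1 v) \<le> B * exp (c * (T - t2)) * G (w - v)" by blast
  obtain \<delta> M where M: "\<delta> > 0" "M \<ge> 0" "\<And>x y t. x \<in> K \<Longrightarrow> norm (y - x) < \<delta> \<Longrightarrow> t \<in> {t0..t2} \<Longrightarrow>
      norm (sol f t t0 y - sol f t t0 x) \<le> M * norm (y - x)"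
    using sol_lipschitz_near[OF K order_refl t2(2)] by blast
  \<comment> \<open>\<open>M\<close> alone serves the times up to \<open>t2\<close>. For later times
    \<open>M\<close> carries the initial distance to \<open>t1\<close>, \<open>B\<close> the flow
    from there on, and \<open>CG / cg\<close> the change of norm.\<close>
  define A where "A = M + B * CG * M / cg"
  have A: "M \<le> A" "B * CG * M / cg \<le> A" using M B CG cg by (auto simp: A_def)
  show ?thesis
  proof (rule top_entropy_le_expansion[OF K g c(1) M(1)])
    fix x y T t assume xy: "x \<in> K" "y \<in> K" "norm (y - x) < \<delta>" and t: "t \<in> {t0..t0 + T}"
    have T: "0 \<le> T" using t by simp
    show "norm (sol f t t0 y - sol f t t0 x) \<le> A * exp (c * T) * norm (y - x)"
    proof (cases "t \<le> t2")
      case True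
      then have "norm (sol f t t0 y - sol f t t0 x) \<le> M * norm (y - x)" using M(3) xy t by simp
      also have "\<dots> \<le> A * norm (y - x)" using A by (intro mult_right_mono) auto
      also have "\<dots> \<le> (A * exp (c * T)) * norm (y - x)"
      proof (intro mult_right_mono)
        have "A * 1 \<le> A * exp (c * T)" using A M(2) c T by (intro mult_left_mono) auto
        then show "A \<le> A * exp (c * T)" by simp
      qed simp
      finally show ?thesis .
    next
      case False
      define v w where "v = sol f t1 t0 x" and "w = sol f t1 t0 y"
      have vw: "v \<in> H" "w \<in> H" using xy by (auto simp: v_def w_def H_def intro: hull_inc)
      have semi: "sol f t t1 v = sol f t t0 x" "sol f t t1 w = sol f t t0 y"
        unfolding v_def w_def by (rule sol_semigroup; use t1 t2 False in simp)+
      have "cg * norm (sol f t t0 y - sol f t t0 x) \<le> G (sol f t t1 w - sol f t t1 v)"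
        unfolding semi by (rule cg(2))
      also have "\<dots> \<le> B * exp (c * (t - t2)) * G (w - v)" using B(2) False vw by simp
      also have "\<dots> \<le> B * exp (c * T) * (CG * (M * norm (y - x)))"
      proof (intro mult_mono)
        show "exp (c * (t - t2)) \<le> exp (c * T)" using t t2 c by (simp add: mult_left_mono)
        have "norm (w - v) \<le> M * norm (y - x)" unfolding v_def w_def by (rule M(3)) (use xy t1 t2 in auto)
        then have "CG * norm (w - v) \<le> CG * (M * norm (y - x))" using CG(1) by simp
        then show "G (w - v) \<le> CG * (M * norm (y - x))" using CG(2)[of "w - v"] by simp
      qed (use B norm_onD(1)[OF G] in auto)
      finally have "norm (sol f t t0 y - sol f t t0 x) \<le> (B * CG * M / cg) * (exp (c * T) * norm (y - x))"
        using cg(1) by (simp add: field_simps)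
      also have "\<dots> \<le> A * (exp (c * T) * norm (y - x))" using A(2) by (intro mult_right_mono) auto
      finally show ?thesis by (simp add: mult.assoc)
    qed
  qed
qed

theorem corollary4:
  fixes f :: "real \<Rightarrow> real ^ 'n \<Rightarrow> real ^ 'n"
    and t0 :: real
    and K :: "(real ^ 'n) set"
    and blk :: "'n \<Rightarrow> 'm::finite"
    and lnrm :: "'m \<Rightarrow> real ^ 'n \<Rightarrow> real"
    and nnrm :: "real ^ 'm \<Rightarrow> real"
    and gnrm :: "real ^ 'n \<Rightarrow> real"
  assumes "CARD('m) \<ge> 2"
    and "surj blk"
    and "\<And>x. piecewise_continuous_from t0 (\<lambda>t. f t x)"
    and "\<And>t. t \<ge> t0 \<Longrightarrow> C1_map (f t)"
    and "local_lipschitz {t0..} UNIV f"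
    and "forward_complete f t0"
    and "\<And>i. norm_on (block_space blk i) (lnrm i)"
    and "norm_on UNIV nnrm"
    and "monotone_norm nnrm"
    and "norm_on UNIV gnrm"
    and "compact K"
    and "interior K \<noteq> {}"
  shows "top_entropy gnrm f t0 K
           \<le> ereal (real CARD('n)) * max (asymp_measure blk lnrm nnrm f t0 K) 0"
proof -
  interpret forward_complete_ode f t0 by unfold_locales fact+
  define A where "A = max (asymp_measure blk lnrm nnrm f t0 K) 0"
  have A0: "0 \<le> A" by (simp add: A_def)
  have le: "top_entropy gnrm f t0 K \<le> ereal (real CARD('n) * c)" if "A < ereal c" for c
  proof (rule top_entropy_le_asymp_measure[OF assms(2,4,7-11)])
    show "0 \<le> c" using that A0 by (metis ereal_less_eq(5) less_imp_le order_le_less_trans)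
    show "asymp_measure blk lnrm nnrm f t0 K < ereal c" using that by (simp add: A_def)
  qed
  have "top_entropy gnrm f t0 K \<le> ereal (real CARD('n)) * A"
  \<comment> \<open>\<open>A\<close> may be infinite: then the right-hand side is infinite too,
    since the dimension is positive. \<open>A0\<close> excludes minus infinity.\<close>
  proof (cases A)
    case (real a)
    show ?thesis
    proof (rule ereal_le_epsilon2)
      fix e :: real assume e: "e > 0"
      \<comment> \<open>The slack in \<open>c\<close> is \<open>e\<close> divided by the dimension,
        so that multiplying by the dimension returns exactly \<open>e\<close>.\<close>
      have "top_entropy gnrm f t0 K \<le> ereal (real CARD('n) * (a + e / real CARD('n)))"
        by (rule le) (use e in \<open>simp add: real\<close>)
      also have "\<dots> = ereal (real CARD('n)) * A + ereal e" by (simp add: real distrib_left)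
      finally show "top_entropy gnrm f t0 K \<le> ereal (real CARD('n)) * A + ereal e" .
    qed
  qed (use A0 in auto)
  then show ?thesis by (simp add: A_def)
qed

end
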